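(* Let $k\ge1$ be an integer. Then, as formal power series in $q,z$, $$\chi_{k,3;([\frac{k+1}2],k)}(q,z)=\sum_{n=0}^\infty\ \sum_{\substack{m_1,\dots,m_k\ge0\\ m_1+2m_2+\cdots+km_k=n}}\frac{q^{\frac12\left({}^t\mathbf mB\mathbf m-(\operatorname{diag}B)\cdot\mathbf m\right)+\mathbf c^{(2)}_{[\frac{k+1}2]}\cdot\mathbf m}}{(q)_{m_1}\cdots(q)_{m_k}}\,z^n,$$ where $[\,\cdot\,]$ is the integer part, $\mathbf m={}^t(m_1,\dots,m_k)$, $B=(B_{ab})_{1\le a,b\le k}$ with $B_{ab}=2\min(a,b)+\max(a+b-k,0)$, $\operatorname{diag}B$ is the vector of diagonal entries of $B$, and, for $0\le b_0\le k$, $\mathbf c^{(2)}_{b_0}=(0,\dots,0,1,2,\dots,k-b_0)\in\mathbb Z^k$ (its $a$-th entry is $\max(a-b_0,0)$).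
   Context: A sequence $\mathbf a=(a_i)_{i\ge0}$ of integers with finitely many non-zero entries is $(k,3)$-admissible if $0\le a_i\le k$ and $a_i+a_{i+1}+a_{i+2}\le k$ for all $i\ge0$. For $0\le b_0\le b_1\le k$ let $C^{(k,3)}_{(b_0,b_1)}$ be the set of $(k,3)$-admissible sequences with $a_0\le b_0$ and $a_0+a_1\le b_1$ (for $b_1=k$ the second condition is automatic). The character of $(k,3)$-admissible configurations is $$\chi_{k,3;(b_0,b_1)}(q,z)=\sum_{\mathbf a\in C^{(k,3)}_{(b_0,b_1)}}q^{\sum_{j\ge0}ja_j}z^{\sum_{j\ge0}a_j}.$$ Also $(q)_m=\prod_{j=1}^m(1-q^j)$. *)

theory Defs
  imports Complex_Main "HOL-Computational_Algebra.Formal_Power_Series"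
begin

text \<open>
  A sequence of non-negative integers is a function from \<open>nat\<close> to \<open>nat\<close>, so the condition
  \<open>0 \<le> a i\<close> is carried by the type.
\<close>

definition admissible3 :: "nat \<Rightarrow> (nat \<Rightarrow> nat) \<Rightarrow> bool" where
  "admissible3 k a \<longleftrightarrow>
     finite {i. a i \<noteq> 0} \<and> (\<forall>i. a i \<le> k) \<and> (\<forall>i. a i + a (i + 1) + a (i + 2) \<le> k)"

definition configs3 :: "nat \<Rightarrow> nat \<Rightarrow> nat \<Rightarrow> (nat \<Rightarrow> nat) set" where
  "configs3 k b0 b1 = {a. admissible3 k a \<and> a 0 \<le> b0 \<and> a 0 + a 1 \<le> b1}"

definition weight :: "(nat \<Rightarrow> nat) \<Rightarrow> nat" where
  "weight a = (\<Sum>j | a j \<noteq> 0. a j)"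

definition energy :: "(nat \<Rightarrow> nat) \<Rightarrow> nat" where
  "energy a = (\<Sum>j | a j \<noteq> 0. j * a j)"

text \<open>
  Formal power series in \<open>q\<close> and \<open>z\<close> are series in \<open>z\<close> (outer type constructor) whose
  coefficients are series in \<open>q\<close> (inner one). The sum over configurations is taken
  coefficientwise: the coefficient of \<open>q\<^sup>d z\<^sup>n\<close> is the number of configurations of energy \<open>d\<close> and
  weight \<open>n\<close>, and there are only finitely many of these.
\<close>

lemma finite_configs3_energy: "finite {a \<in> configs3 k b0 b1. energy a = d}"
proof (rule finite_subset)
  show "finite {a. (\<forall>i. (i \<in> {..d} \<longrightarrow> a i \<in> {..k}) \<and> (i \<notin> {..d} \<longrightarrow> a i = (0::nat)))}"
    by (rule finite_set_of_finite_funs) auto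
  show "{a \<in> configs3 k b0 b1. energy a = d} \<subseteq> {a. (\<forall>i. (i \<in> {..d} \<longrightarrow> a i \<in> {..k}) \<and> (i \<notin> {..d} \<longrightarrow> a i = (0::nat)))}"
  proof clarify
    fix a i
    assume a: "a \<in> configs3 k b0 b1" and d: "d = energy a"
    have fin: "finite {j. a j \<noteq> 0}" and le: "a i \<le> k"
      using a by (auto simp: configs3_def admissible3_def)
    have "i \<le> energy a" if "a i \<noteq> 0"
    proof -
      have "i \<le> i * a i" using that by simp
      also have "\<dots> \<le> energy a"
        unfolding energy_def using fin that by (intro member_le_sum) auto
      finally show ?thesis .
    qed
    then show "(i \<in> {..energy a} \<longrightarrow> a i \<in> {..k}) \<and> (i \<notin> {..energy a} \<longrightarrow> a i = 0)"
      using le by auto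
  qed
qed

definition character3 :: "nat \<Rightarrow> nat \<Rightarrow> nat \<Rightarrow> rat fps fps" where
  "character3 k b0 b1 =
     Abs_fps (\<lambda>n. Abs_fps (\<lambda>d. of_nat (card {a \<in> configs3 k b0 b1. energy a = d \<and> weight a = n})))"

definition q_factorial :: "nat \<Rightarrow> rat fps" where
  "q_factorial m = (\<Prod>j=1..m. (1 - fps_X ^ j))"

definition Bmat :: "nat \<Rightarrow> nat \<Rightarrow> nat \<Rightarrow> int" where
  "Bmat k a b = 2 * int (min a b) + max (int a + int b - int k) 0"

definition cvec2 :: "nat \<Rightarrow> nat \<Rightarrow> int" where
  "cvec2 b0 a = max (int a - int b0) 0"

definition quad_part :: "nat \<Rightarrow> (nat \<Rightarrow> nat) \<Rightarrow> int" where
  "quad_part k m = (\<Sum>a=1..k. \<Sum>b=1..k. int (m a) * Bmat k a b * int (m b))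
                   - (\<Sum>a=1..k. Bmat k a a * int (m a))"

definition exponent :: "nat \<Rightarrow> nat \<Rightarrow> (nat \<Rightarrow> nat) \<Rightarrow> int" where
  "exponent k b0 m = quad_part k m div 2 + (\<Sum>a=1..k. cvec2 b0 a * int (m a))"

text \<open>The division by 2 is exact and the exponent is non-negative, so \<open>nat\<close> loses nothing.\<close>

lemma Bmat_sym: "Bmat k a b = Bmat k b a"
  by (simp add: Bmat_def min.commute add.commute)

lemma Bmat_nonneg: "0 \<le> Bmat k a b"
  by (simp add: Bmat_def)

lemma even_quad_part: "even (quad_part k m)"
proof -
  define f where "f a b = int (m a) * Bmat k a b * int (m b)" for a b
  have sym: "f a b = f b a" for a b
    by (simp add: f_def Bmat_sym[of k a b])
  have "even ((\<Sum>a=1..n. \<Sum>b=1..n. f a b) - (\<Sum>a=1..n. f a a))" for n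
  proof (induction n)
    case (Suc n)
    have "(\<Sum>a=1..Suc n. \<Sum>b=1..Suc n. f a b) - (\<Sum>a=1..Suc n. f a a)
        = ((\<Sum>a=1..n. \<Sum>b=1..n. f a b) - (\<Sum>a=1..n. f a a)) + 2 * (\<Sum>b=1..n. f (Suc n) b)"
    proof -
      have "(\<Sum>a=1..n. f a (Suc n)) = (\<Sum>b=1..n. f (Suc n) b)"
        by (rule sum.cong[OF refl sym])
      then show ?thesis by (simp add: sum.distrib)
    qed
    with Suc show ?case by simp
  qed simp
  moreover have "even ((\<Sum>a=1..k. f a a) - (\<Sum>a=1..k. Bmat k a a * int (m a)))"
    unfolding sum_subtractf[symmetric]
  proof (rule dvd_sum)
    fix a
    have "f a a - Bmat k a a * int (m a) = Bmat k a a * (int (m a) * (int (m a) - 1))"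
      by (simp add: f_def algebra_simps)
    then show "even (f a a - Bmat k a a * int (m a))" by simp
  qed
  ultimately have "even (((\<Sum>a=1..k. \<Sum>b=1..k. f a b) - (\<Sum>a=1..k. f a a))
      + ((\<Sum>a=1..k. f a a) - (\<Sum>a=1..k. Bmat k a a * int (m a))))"
    by (rule dvd_add)
  then show ?thesis by (simp add: quad_part_def f_def)
qed

lemma exponent_nonneg: "0 \<le> exponent k b0 m"
proof -
  have "(\<Sum>a=1..k. Bmat k a a * int (m a)) \<le> (\<Sum>a=1..k. \<Sum>b=1..k. int (m a) * Bmat k a b * int (m b))"
  proof (rule sum_mono)
    fix a assume a: "a \<in> {1..k}"
    have "int (m a) * 1 \<le> int (m a) * int (m a)"
      by (cases "m a") (auto intro!: mult_left_mono)
    then have "Bmat k a a * int (m a) \<le> int (m a) * Bmat k a a * int (m a)"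
      using mult_left_mono[of "int (m a) * 1" "int (m a) * int (m a)" "Bmat k a a"] Bmat_nonneg[of k a a]
      by (simp add: mult_ac)
    also have "\<dots> \<le> (\<Sum>b=1..k. int (m a) * Bmat k a b * int (m b))"
      using a by (intro member_le_sum[where f = "\<lambda>b. int (m a) * Bmat k a b * int (m b)"])
        (auto simp: Bmat_nonneg)
    finally show "Bmat k a a * int (m a) \<le> (\<Sum>b=1..k. int (m a) * Bmat k a b * int (m b))" .
  qed
  moreover have "0 \<le> (\<Sum>a=1..k. cvec2 b0 a * int (m a))"
    by (intro sum_nonneg) (simp add: cvec2_def)
  ultimately show ?thesis by (simp add: exponent_def quad_part_def pos_imp_zdiv_nonneg_iff)
qed

text \<open>The vectors \<open>(m\<^sub>1, \<dots>, m\<^sub>k)\<close> are functions supported on \<open>{1..k}\<close>.\<close>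

definition mvecs :: "nat \<Rightarrow> nat \<Rightarrow> (nat \<Rightarrow> nat) set" where
  "mvecs k n = {m. (\<forall>a. a \<notin> {1..k} \<longrightarrow> m a = 0) \<and> (\<Sum>a=1..k. a * m a) = n}"

lemma finite_mvecs: "finite (mvecs k n)"
proof (rule finite_subset)
  show "finite {m. (\<forall>a. (a \<in> {1..k} \<longrightarrow> m a \<in> {..n}) \<and> (a \<notin> {1..k} \<longrightarrow> m a = (0::nat)))}"
    by (rule finite_set_of_finite_funs) auto
  show "mvecs k n \<subseteq> {m. (\<forall>a. (a \<in> {1..k} \<longrightarrow> m a \<in> {..n}) \<and> (a \<notin> {1..k} \<longrightarrow> m a = (0::nat)))}"
  proof clarify
    fix m a assume m: "m \<in> mvecs k n"
    have "m a \<le> n" if "a \<in> {1..k}"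
    proof -
      have "m a \<le> a * m a" using that by simp
      also have "\<dots> \<le> (\<Sum>a=1..k. a * m a)"
        using that by (intro member_le_sum[where f = "\<lambda>a. a * m a"]) auto
      finally show ?thesis using m by (simp add: mvecs_def)
    qed
    then show "(a \<in> {1..k} \<longrightarrow> m a \<in> {..n}) \<and> (a \<notin> {1..k} \<longrightarrow> m a = 0)"
      using m by (auto simp: mvecs_def)
  qed
qed

end

theory Submission
  imports Defs
begin

text \<open>
  Write \<open>F(u)\<close> for the fermionic sum with linear term \<open>u \<cdot> m\<close>, and \<open>g(j)\<close> for the vector with entries
  \<open>max(a - j, 0)\<close>. Let \<open>X(b, p, c)\<close>, \<open>b + p + c = k\<close>, be the character of the configurations that can
  follow two entries \<open>b, p\<close>. Reading off the first entry gives a recursion in \<open>z \<mapsto> qz\<close> with a unique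
  solution, and this solution is an analogue of a Jacobi--Trudi determinant:
  \<open>z^p X(b, p, c; qz) = F(g(p) + g(p + c)) - F(g(p - 1) + g(p + c + 1))\<close>, without the second term when
  \<open>p = 0\<close>. The case \<open>p = 0\<close> is the theorem, for an arbitrary \<open>b0 = c\<close>.

  The recursion for the right hand side is refined by a variable \<open>y\<close> marking \<open>M = m1 + \<dots> + mk\<close> and by a
  charge \<open>0\<close>. It then has a companion identity, and the pair is proved by induction from \<open>k\<close> to
  \<open>k + 2\<close>. Raising all charges by one adds \<open>2\<close> to every entry of \<open>B\<close>, which amounts to
  \<open>y^M \<mapsto> q^(M(M-1)) z^M y^M\<close>. The new highest charge \<open>k + 2\<close> interacts with the charge \<open>a\<close> by \<open>3a\<close>, so
  \<open>m\<close> particles of that charge only substitute \<open>q^(3m) z\<close> for \<open>z\<close>. The charge \<open>0\<close> contributes a factor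
  \<open>1/(y)\<^sub>\<infinity>\<close>. After these steps the defects of the two identities are multiples of each other, with a
  factor \<open>y\<close>, so that both vanish.
\<close>

unbundle fps_syntax

section \<open>Fermionic sums\<close>

type_synonym qser = "rat fps"
type_synonym ser3 = "rat fps fps fps"

definition qv :: ser3 where "qv = fps_const (fps_const fps_X)"
definition zv :: ser3 where "zv = fps_const fps_X"
definition yv :: ser3 where "yv = fps_X"

lemma qv_power_nth: "(qv ^ i * f) $ M = fps_const (fps_X ^ i) * f $ M"
  by (simp add: qv_def fps_const_power)

lemma zv_power_nth: "(zv ^ i * f) $ M = fps_X ^ i * f $ M"
  by (simp add: zv_def fps_const_power)

lemma yv_nth: "(yv * f) $ M = (if M = 0 then 0 else f $ (M - 1))"
  by (simp add: yv_def)

lemma q_factorial_Suc: "q_factorial (Suc m) = q_factorial m * (1 - fps_X ^ Suc m)"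
  by (simp add: q_factorial_def)

lemma q_factorial_nth_0: "q_factorial m $ 0 = 1"
  by (induction m) (simp_all add: q_factorial_def)

lemma q_factorial_inverse: "inverse (q_factorial m) = (1 - fps_X ^ Suc m) * inverse (q_factorial (Suc m))"
proof -
  have nz: "(1 - fps_X ^ Suc m :: rat fps) $ 0 \<noteq> 0" by simp
  have "inverse (q_factorial (Suc m)) = inverse (q_factorial m) * inverse (1 - fps_X ^ Suc m)"
    by (simp only: q_factorial_Suc fps_inverse_mult)
  then show ?thesis using inverse_mult_eq_1'[OF nz] by (simp add: mult_ac)
qed

text \<open>Half of \<open>c\<close> * m^2 - \<open>c\<close> * m is \<open>c\<close> times
  \<open>m choose 2\<close>, so a diagonal entry \<open>c\<close> of the form gives a natural
  exponent without any halving.\<close>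

definition qker :: "nat \<Rightarrow> nat \<Rightarrow> nat \<Rightarrow> qser" where
  "qker c e m = fps_X ^ (c * (m choose 2) + e * m) * inverse (q_factorial m)"

text \<open>The sum of y^m z^(a m) \<open>qker c e m\<close> f(m) over all m, stored by powers of
  \<open>yv\<close>, so that each coefficient is a finite sum. The argument \<open>f\<close> depends
  on m because the other charges feel the m particles already placed.\<close>

definition msum :: "nat \<Rightarrow> nat \<Rightarrow> nat \<Rightarrow> (nat \<Rightarrow> ser3) \<Rightarrow> ser3" where
  "msum a c e f = Abs_fps (\<lambda>M. \<Sum>m\<le>M. fps_X ^ (a * m) * fps_const (qker c e m) * f m $ (M - m))"

lemma msum_nth: "msum a c e f $ M = (\<Sum>m\<le>M. fps_X ^ (a * m) * fps_const (qker c e m) * f m $ (M - m))"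
  by (simp add: msum_def)

lemma msum_add: "msum a c e (\<lambda>m. f m + g m) = msum a c e f + msum a c e g"
  by (rule fps_ext) (simp add: msum_nth sum.distrib distrib_left)

lemma msum_diff: "msum a c e (\<lambda>m. f m - g m) = msum a c e f - msum a c e g"
  by (rule fps_ext) (simp add: msum_nth sum_subtractf right_diff_distrib)

lemma msum_zv: "msum a c e (\<lambda>m. zv ^ p * f m) = zv ^ p * msum a c e f"
  by (rule fps_ext) (simp only: msum_nth zv_power_nth sum_distrib_left, simp add: mult_ac)

lemma qker_add: "qker c (e + d) m = fps_X ^ (d * m) * qker c e m"
  by (simp add: qker_def power_add algebra_simps)

lemma msum_qv: "msum a c e (\<lambda>m. qv ^ (i + d * m) * f m) = qv ^ i * msum a c (e + d) f"
  by (rule fps_ext) (simp only: msum_nth qv_power_nth sum_distrib_left qker_add,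
      simp add: power_add mult_ac flip: fps_const_mult)

lemma msum_yv: "msum a c e (\<lambda>m. yv * f m) = yv * msum a c e f"
proof (rule fps_ext)
  fix M
  show "msum a c e (\<lambda>m. yv * f m) $ M = (yv * msum a c e f) $ M"
  proof (cases M)
    case (Suc M')
    have "(\<Sum>m\<le>M'. fps_X ^ (a * m) * fps_const (qker c e m) * (yv * f m) $ (Suc M' - m))
       = (\<Sum>m\<le>M'. fps_X ^ (a * m) * fps_const (qker c e m) * f m $ (M' - m))"
      by (rule sum.cong) (auto simp: yv_nth Suc_diff_le)
    then show ?thesis by (simp add: Suc msum_nth yv_nth)
  qed (simp add: msum_nth yv_nth)
qed

text \<open>Raising e by one produces the factor 1 - q^(m+1), which cancels the last factor of
  (q)_(m+1).\<close>

lemma qker_step: "qker c e (Suc m) - qker c (Suc e) (Suc m) = fps_X ^ e * qker c (e + c) m"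
proof -
  have ch: "Suc m choose 2 = (m choose 2) + m" by (simp add: numeral_2_eq_2)
  have "qker c e (Suc m) - qker c (Suc e) (Suc m)
      = fps_X ^ (c * (Suc m choose 2) + e * Suc m) * ((1 - fps_X ^ Suc m) * inverse (q_factorial (Suc m)))"
    by (simp add: qker_def power_add algebra_simps)
  also have "\<dots> = fps_X ^ (c * (Suc m choose 2) + e * Suc m) * inverse (q_factorial m)"
    by (simp only: q_factorial_inverse[symmetric])
  also have "\<dots> = fps_X ^ e * qker c (e + c) m"
    by (simp add: qker_def ch power_add algebra_simps)
  finally show ?thesis .
qed

lemma msum_step:
  "msum a c e f - msum a c (Suc e) f = yv * zv ^ a * qv ^ e * msum a c (e + c) (\<lambda>m. f (Suc m))"
proof (rule fps_ext)
  fix M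
  let ?R = "msum a c (e + c) (\<lambda>m. f (Suc m))"
  have r: "(yv * zv ^ a * qv ^ e * ?R) $ M
     = (if M = 0 then 0 else fps_X ^ a * (fps_const (fps_X ^ e) * ?R $ (M - 1)))"
    by (simp add: mult.assoc yv_nth zv_power_nth qv_power_nth)
  have d: "(msum a c e f - msum a c (Suc e) f) $ M = (\<Sum>m\<le>M. fps_X ^ (a * m) *
      fps_const (qker c e m - qker c (Suc e) m) * f m $ (M - m))"
    by (simp add: msum_nth algebra_simps flip: sum_subtractf fps_const_sub)
  show "(msum a c e f - msum a c (Suc e) f) $ M = (yv * zv ^ a * qv ^ e * ?R) $ M"
  proof (cases M)
    case 0
    then show ?thesis unfolding d r by (simp add: qker_def)
  next
    case (Suc M')
    have "(\<Sum>m\<le>M. fps_X ^ (a * m) * fps_const (qker c e m - qker c (Suc e) m) * f m $ (M - m))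
        = (\<Sum>m\<le>M'. fps_X ^ (a * Suc m) * fps_const (qker c e (Suc m) - qker c (Suc e) (Suc m)) * f (Suc m) $ (M' - m))"
      unfolding Suc by (subst sum.atMost_Suc_shift) (simp add: qker_def)
    also have "\<dots> = fps_X ^ a * (fps_const (fps_X ^ e) * ?R $ M')"
      unfolding qker_step by (simp add: msum_nth sum_distrib_left power_add mult_ac flip: fps_const_mult)
    finally show ?thesis unfolding d r by (simp add: Suc)
  qed
qed

text \<open>The matrix \<open>Bmat\<close> with natural entries; truncated subtraction supplies the
  maximum with 0.\<close>

definition Bn :: "nat \<Rightarrow> nat \<Rightarrow> nat \<Rightarrow> nat" where
  "Bn N a b = 2 * min a b + (a + b - N)"

lemma Bn_sym: "Bn N a b = Bn N b a"
  by (simp add: Bn_def min.commute add.commute)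

lemma Bn_Suc: "Bn (N + 2) (Suc a) (Suc b) = Bn N a b + 2"
  by (simp add: Bn_def)

text \<open>The sum over all \<open>m\<close> supported on the listed charges, with \<open>yv\<close> marking \<open>\<Sum> m\<close>. Summing over the
  multiplicity \<open>m\<close> of the first charge \<open>a\<close> leaves a sum of the same kind with \<open>u\<close> shifted by \<open>m\<close> times row \<open>a\<close> of \<open>Bn\<close>.\<close>

fun fser :: "nat \<Rightarrow> nat list \<Rightarrow> (nat \<Rightarrow> nat) \<Rightarrow> ser3" where
  "fser N [] u = 1"
| "fser N (a # as) u = msum a (Bn N a a) (u a) (\<lambda>m. fser N as (\<lambda>b. u b + m * Bn N a b))"

lemma fser_cong: "(\<And>b. b \<in> set as \<Longrightarrow> u b = v b) \<Longrightarrow> fser N as u = fser N as v"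
proof (induction as arbitrary: u v)
  case (Cons a as)
  have "fser N as (\<lambda>b. u b + m * Bn N a b) = fser N as (\<lambda>b. v b + m * Bn N a b)" for m
    using Cons.prems by (intro Cons.IH) simp
  with Cons.prems show ?case by simp
qed simp

text \<open>This is \<open>msum_step\<close> inside the full sum: removing one particle of charge
  \<open>a\<close> leaves its row of \<open>Bn\<close> as a shift of the linear term.\<close>

lemma fser_step:
  assumes "distinct as" "a \<in> set as" "v a = Suc (u a)" "\<And>b. b \<in> set as \<Longrightarrow> b \<noteq> a \<Longrightarrow> v b = u b"
  shows "fser N as u - fser N as v = yv * zv ^ a * qv ^ u a * fser N as (\<lambda>b. u b + Bn N a b)"
  using assms
proof (induction as arbitrary: u v)
  case (Cons x as)
  show ?case
  proof (cases "x = a")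
    case True
    then have "fser N as (\<lambda>b. v b + m * Bn N a b) = fser N as (\<lambda>b. u b + m * Bn N a b)" for m
      using Cons.prems by (intro fser_cong) auto
    then have "fser N (x # as) u - fser N (x # as) v
      = msum a (Bn N a a) (u a) (\<lambda>m. fser N as (\<lambda>b. u b + m * Bn N a b))
      - msum a (Bn N a a) (Suc (u a)) (\<lambda>m. fser N as (\<lambda>b. u b + m * Bn N a b))"
      using Cons.prems True by simp
    also have "\<dots> = yv * zv ^ a * qv ^ u a * msum a (Bn N a a) (u a + Bn N a a)
        (\<lambda>m. fser N as (\<lambda>b. u b + Suc m * Bn N a b))"
      by (rule msum_step)
    finally show ?thesis using True by (simp add: add_ac)
  next
    case False
    \<comment> \<open>With m particles of charge x present, the extracted particle carries an extra
      q^(m * \<open>Bn N a x\<close>), which \<open>msum_qv\<close> turns into a shift of the linear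
      term at x.\<close>
    have IH: "fser N as (\<lambda>b. u b + m * Bn N x b) - fser N as (\<lambda>b. v b + m * Bn N x b)
      = yv * (zv ^ a * (qv ^ (u a + Bn N a x * m) * fser N as (\<lambda>b. u b + Bn N a b + m * Bn N x b)))" for m
      using Cons.IH[of "\<lambda>b. v b + m * Bn N x b" "\<lambda>b. u b + m * Bn N x b"] Cons.prems False
      by (simp add: add_ac mult_ac Bn_sym)
    have vx: "v x = u x" using Cons.prems False by auto
    have "fser N (x # as) u - fser N (x # as) v = msum x (Bn N x x) (u x)
        (\<lambda>m. fser N as (\<lambda>b. u b + m * Bn N x b) - fser N as (\<lambda>b. v b + m * Bn N x b))"
      by (simp add: msum_diff vx)
    also have "\<dots> = yv * (zv ^ a * (qv ^ u a * fser N (x # as) (\<lambda>b. u b + Bn N a b)))"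
      unfolding IH msum_yv msum_zv msum_qv by simp
    finally show ?thesis by (simp add: mult_ac)
  qed
qed simp

text \<open>A constant in the linear term counts particles, so it acts as the substitution of q^d y
  for y.\<close>

lemma fser_shift_nth:
  "fser N as (\<lambda>b. u b + d) $ M = fps_const (fps_X ^ (d * M)) * fser N as u $ M"
proof (induction as arbitrary: u M)
  case Nil
  then show ?case by (cases M) auto
next
  case (Cons a as)
  have IH: "fser N as (\<lambda>b. u b + d + m * Bn N a b) $ M
     = fps_const (fps_X ^ (d * M)) * fser N as (\<lambda>b. u b + m * Bn N a b) $ M" for m M
    using Cons.IH[of "\<lambda>b. u b + m * Bn N a b"] by (simp add: add_ac)
  have "fps_X ^ (a * m) * fps_const (qker (Bn N a a) (u a + d) m) *
        (fps_const (fps_X ^ (d * (M - m))) * fser N as (\<lambda>b. u b + m * Bn N a b) $ (M - m))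
     = fps_const (fps_X ^ (d * M)) * (fps_X ^ (a * m) * fps_const (qker (Bn N a a) (u a) m) *
        fser N as (\<lambda>b. u b + m * Bn N a b) $ (M - m))" if "m \<le> M" for m
  proof -
    have "d * m + d * (M - m) = d * M" using that by (simp flip: distrib_left)
    then have "fps_X ^ (d * M) = (fps_X ^ (d * m) * fps_X ^ (d * (M - m)) :: rat fps)"
      by (simp flip: power_add)
    then show ?thesis by (simp add: qker_add mult_ac flip: fps_const_mult)
  qed
  then show ?case by (auto simp only: fser.simps msum_nth IH sum_distrib_left atMost_iff intro!: sum.cong)
qed

section \<open>Raising all charges by one\<close>

definition raise_charges :: "ser3 \<Rightarrow> ser3" where
  "raise_charges f = Abs_fps (\<lambda>M. fps_const (fps_X ^ (M * (M - 1))) * fps_X ^ M * f $ M)"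

lemma raise_charges_nth: "raise_charges f $ M = fps_const (fps_X ^ (M * (M - 1))) * fps_X ^ M * f $ M"
  by (simp add: raise_charges_def)

lemma raise_charges_add: "raise_charges (f + g) = raise_charges f + raise_charges g"
  by (rule fps_ext) (simp add: raise_charges_nth distrib_left)

lemma raise_charges_diff: "raise_charges (f - g) = raise_charges f - raise_charges g"
  by (rule fps_ext) (simp add: raise_charges_nth right_diff_distrib)

lemma raise_charges_qv: "raise_charges (qv ^ i * f) = qv ^ i * raise_charges f"
  by (rule fps_ext) (simp only: raise_charges_nth qv_power_nth, simp add: mult_ac)

lemma raise_charges_zv: "raise_charges (zv ^ i * f) = zv ^ i * raise_charges f"
  by (rule fps_ext) (simp only: raise_charges_nth zv_power_nth, simp add: mult_ac)

text \<open>Since (K + 1) K = K (K - 1) + 2 K, moving y out costs one z and the substitution of q^2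
  y for y.\<close>

lemma raise_charges_yv_fser: "raise_charges (yv * fser N as u) = yv * zv * raise_charges (fser N as (\<lambda>b. u b + 2))"
proof (rule fps_ext)
  fix M
  show "raise_charges (yv * fser N as u) $ M = (yv * zv * raise_charges (fser N as (\<lambda>b. u b + 2))) $ M"
  proof (cases M)
    case (Suc K)
    have "Suc K * K = K * (K - 1) + 2 * K" by (cases K) auto
    then have "fps_X ^ (Suc K * K) = (fps_X ^ (K * (K - 1)) * fps_X ^ (2 * K) :: rat fps)"
      by (simp flip: power_add)
    then show ?thesis
      using zv_power_nth[of 1 "raise_charges (fser N as (\<lambda>b. u b + 2))" K] fser_shift_nth[of N as u 2 K]
      by (simp add: Suc raise_charges_nth yv_nth mult.assoc del: mult_Suc add_2_eq_Suc')
  qed (simp add: raise_charges_nth yv_def)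
qed

text \<open>By \<open>Bn_Suc\<close> every entry of the form grows by 2, which adds M (M - 1) to the
  exponent for M particles, and each particle carries one more z.\<close>

lemma fser_map_Suc: "fser (N + 2) (map Suc as) u = raise_charges (fser N as (\<lambda>b. u (Suc b)))"
proof (induction as arbitrary: u)
  case Nil
  show ?case by (rule fps_ext) (simp add: raise_charges_nth)
next
  case (Cons a as)
  show ?case
  proof (rule fps_ext)
    fix M
    let ?f = "\<lambda>m. fser N as (\<lambda>b. u (Suc b) + m * Bn N a b)"
    have IH: "fser (N + 2) (map Suc as) (\<lambda>b. u b + m * Bn (N + 2) (Suc a) b) $ K
        = fps_const (fps_X ^ (K * (K - 1))) * fps_X ^ K * (fps_const (fps_X ^ (2 * m * K)) * ?f m $ K)" for m K
    proof -
      have "(\<lambda>b. u (Suc b) + m * Bn (N + 2) (Suc a) (Suc b)) = (\<lambda>b. u (Suc b) + m * Bn N a b + 2 * m)"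
        unfolding Bn_Suc by (rule ext) (simp only: distrib_left add_ac mult.commute[of m 2])
      then show ?thesis by (simp only: Cons.IH raise_charges_nth fser_shift_nth)
    qed
    have "fps_X ^ (Suc a * m) * fps_const (qker (Bn N a a + 2) (u (Suc a)) m) *
          (fps_const (fps_X ^ ((M - m) * (M - m - 1))) * fps_X ^ (M - m) * (fps_const (fps_X ^ (2 * m * (M - m))) * ?f m $ (M - m)))
        = fps_const (fps_X ^ (M * (M - 1))) * fps_X ^ M * (fps_X ^ (a * m) * fps_const (qker (Bn N a a) (u (Suc a)) m) *
          ?f m $ (M - m))" if mM: "m \<le> M" for m
    proof -
      obtain K where M: "M = m + K" using le_Suc_ex[OF mM] by blast
      have ch: "2 * (m choose 2) = m * (m - 1)" by (cases m) (simp_all add: choose_two)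
      \<comment> \<open>Ordered pairs of distinct particles among M = m + K: within the m, within
        the K, and across.\<close>
      have "2 * (m choose 2) + K * (K - 1) + 2 * m * K = M * (M - 1)"
        unfolding ch M by (cases m; cases K) (auto simp: algebra_simps)
      then have e: "(fps_X ^ (M * (M - 1)) :: rat fps)
          = fps_X ^ (2 * (m choose 2)) * fps_X ^ (K * (K - 1)) * fps_X ^ (2 * m * K)"
        by (simp only: power_add[symmetric])
      have s: "fps_X ^ (Suc a * m) = (fps_X ^ (a * m) * fps_X ^ m :: rat fps fps)"
        "fps_X ^ M = (fps_X ^ m * fps_X ^ K :: rat fps fps)"
        by (simp_all add: power_add M)
      have k: "qker (Bn N a a + 2) e m = fps_X ^ (2 * (m choose 2)) * qker (Bn N a a) e m" for e
        by (simp only: qker_def add_mult_distrib power_add) (simp only: mult_ac)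
      have d: "M - m = K" by (simp add: M)
      show ?thesis
        unfolding e s k d fps_const_mult[symmetric] by (simp only: mult_ac)
    qed
    then show "fser (N + 2) (map Suc (a # as)) u $ M = raise_charges (fser N (a # as) (\<lambda>b. u (Suc b))) $ M"
      by (auto simp only: list.map fser.simps msum_nth raise_charges_nth IH Bn_Suc sum_distrib_left atMost_iff intro!: sum.cong)
  qed
qed

section \<open>Two families of identities and their boundary cases\<close>

text \<open>The indices are shifted by one: \<open>Suc b - P\<close> is \<open>max(b - p, 0)\<close> for \<open>P = p + 1\<close>, and \<open>P = 0\<close> stands for
  \<open>p = -1\<close>. Increasing \<open>\<alpha>\<close> or \<open>\<beta>\<close> by one substitutes \<open>qz\<close> for \<open>z\<close> or \<open>qy\<close> for \<open>y\<close>.\<close>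

definition gser :: "nat \<Rightarrow> nat list \<Rightarrow> nat \<Rightarrow> nat \<Rightarrow> nat \<Rightarrow> nat \<Rightarrow> ser3" where
  "gser N as \<alpha> \<beta> P S = fser N as (\<lambda>b. \<alpha> * b + \<beta> + (Suc b - P) + (Suc b - S))"

text \<open>A determinant-like difference, antisymmetric in \<open>p\<close> and \<open>t\<close>.
  With t = p + c + 1 it is the difference F(g(p) + g(p + c)) - F(g(p - 1) + g(p + c + 1)) for the
  solution of the recursion.\<close>

definition wser :: "nat \<Rightarrow> nat list \<Rightarrow> nat \<Rightarrow> nat \<Rightarrow> nat \<Rightarrow> nat \<Rightarrow> ser3" where
  "wser N as \<alpha> \<beta> p t = gser N as \<alpha> \<beta> (Suc p) t - gser N as \<alpha> \<beta> p (Suc t)"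

definition dser :: "nat \<Rightarrow> nat list \<Rightarrow> nat \<Rightarrow> nat \<Rightarrow> nat \<Rightarrow> nat \<Rightarrow> ser3" where
  "dser N as \<alpha> \<beta> p t = wser N as \<alpha> \<beta> p t - wser N as \<alpha> (Suc \<beta>) (Suc p) t"

text \<open>The charges \<open>0..k\<close>, listed in the order in which the induction from \<open>k\<close> to \<open>k + 2\<close> adjoins them.\<close>

fun charges :: "nat \<Rightarrow> nat list" where
  "charges 0 = [0]"
| "charges (Suc 0) = [0, 1]"
| "charges (Suc (Suc k)) = 0 # Suc (Suc k) # map Suc (charges k)"

lemma set_charges: "set (charges k) = {0..k}"
proof (induction k rule: charges.induct)
  case (3 k)
  have "{0..Suc (Suc k)} = insert 0 (insert (Suc (Suc k)) (Suc ` {0..k}))"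
    by (auto simp: image_iff)
  with 3 show ?case by simp
qed auto

lemma distinct_charges: "distinct (charges k)"
proof (induction k rule: charges.induct)
  case (3 k)
  then show ?case by (auto simp: set_charges distinct_map)
qed auto

text \<open>The refined recursion. For \<open>y = 1\<close> the difference \<open>dser\<close> loses its second term once the charge \<open>0\<close>
  is removed, and this becomes the recursion of the characters.\<close>

definition wrel :: "nat \<Rightarrow> bool" where
  "wrel k \<longleftrightarrow> (\<forall>\<alpha> \<beta> p c b. p + c + b = k \<longrightarrow>
     wser k (charges k) \<alpha> \<beta> p (Suc (p + c)) - wser k (charges k) \<alpha> \<beta> p (p + c) =
     qv ^ (\<alpha> * p) * zv ^ p * dser k (charges k) (Suc \<alpha>) \<beta> c (Suc (b + c)))"

definition drel :: "nat \<Rightarrow> bool" where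
  "drel k \<longleftrightarrow> (\<forall>\<alpha> \<beta> p c b. p + Suc c + b = k \<longrightarrow>
     dser k (charges k) \<alpha> \<beta> p (Suc (p + Suc c)) - dser k (charges k) \<alpha> \<beta> p (p + Suc c) =
     qv ^ \<beta> * yv * (qv ^ (\<alpha> * p) * zv ^ p * wser k (charges k) (Suc \<alpha>) \<beta> (Suc c) (b + Suc c)
       + qv ^ (\<alpha> * (p + Suc c) + Suc c) * zv ^ (p + Suc c) * wser k (charges k) (\<alpha> + 2) \<beta> b (Suc (b + p))))"

lemma gser_cong:
  assumes "\<And>b. b \<in> set as \<Longrightarrow> \<alpha> * b + \<beta> + (Suc b - P) + (Suc b - S) = \<alpha>' * b + \<beta>' + (Suc b - P') + (Suc b - S')"
  shows "gser N as \<alpha> \<beta> P S = gser N as \<alpha>' \<beta>' P' S'"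
  unfolding gser_def using assms by (rule fser_cong)

lemma gser_commute: "gser N as \<alpha> \<beta> P S = gser N as \<alpha> \<beta> S P"
  by (rule gser_cong) simp

text \<open>On charges up to k the index 0 contributes b + 1 and the index \<open>Suc k\<close>
  contributes 0, so the extreme index can be absorbed into \<alpha> and \<beta>.\<close>

lemma gser_0: "gser N as \<alpha> \<beta> 0 S = gser N as (Suc \<alpha>) (Suc \<beta>) (Suc k) S"
  if "set as \<subseteq> {..k}"
  using that by (intro gser_cong) auto

lemma gser_Suc_0: "gser N as \<alpha> \<beta> (Suc 0) S = gser N as (Suc \<alpha>) \<beta> (Suc k) S"
  if "set as \<subseteq> {..k}"
  using that by (intro gser_cong) auto

lemma gser_beyond: "gser N as \<alpha> \<beta> P (Suc (Suc k)) = gser N as \<alpha> \<beta> P (Suc k)"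
  if "set as \<subseteq> {..k}"
  using that by (intro gser_cong) auto

lemma wser_diag: "wser N as \<alpha> \<beta> p p = 0"
  by (simp add: wser_def gser_commute[of N as \<alpha> \<beta> "Suc p"])

lemma gser_step:
  assumes "distinct as" "a \<in> set as"
    "\<alpha>' * a + \<beta>' + (Suc a - P') + (Suc a - S') = Suc (\<alpha> * a + \<beta> + (Suc a - P) + (Suc a - S))"
    "\<And>b. b \<in> set as \<Longrightarrow> b \<noteq> a \<Longrightarrow>
       \<alpha>' * b + \<beta>' + (Suc b - P') + (Suc b - S') = \<alpha> * b + \<beta> + (Suc b - P) + (Suc b - S)"
    "\<And>b. b \<in> set as \<Longrightarrow>
       \<alpha> * b + \<beta> + (Suc b - P) + (Suc b - S) + Bn N a b = \<alpha>'' * b + \<beta>'' + (Suc b - P'') + (Suc b - S'')"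
  shows "gser N as \<alpha> \<beta> P S - gser N as \<alpha>' \<beta>' P' S'
    = yv * zv ^ a * qv ^ (\<alpha> * a + \<beta> + (Suc a - P) + (Suc a - S)) * gser N as \<alpha>'' \<beta>'' P'' S''"
proof -
  have "gser N as \<alpha> \<beta> P S - gser N as \<alpha>' \<beta>' P' S'
    = yv * zv ^ a * qv ^ (\<alpha> * a + \<beta> + (Suc a - P) + (Suc a - S)) *
      fser N as (\<lambda>b. \<alpha> * b + \<beta> + (Suc b - P) + (Suc b - S) + Bn N a b)"
    unfolding gser_def by (rule fser_step) (use assms in auto)
  also have "fser N as (\<lambda>b. \<alpha> * b + \<beta> + (Suc b - P) + (Suc b - S) + Bn N a b) = gser N as \<alpha>'' \<beta>'' P'' S''"
    unfolding gser_def by (rule fser_cong) (use assms in auto)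
  finally show ?thesis .
qed

context
  fixes k :: nat
begin

private abbreviation "G \<equiv> gser k (charges k)"
private abbreviation "W \<equiv> wser k (charges k)"
private abbreviation "R \<equiv> dser k (charges k)"

text \<open>The two linear terms differ only at the charge P, by one. Row P of \<open>Bn\<close>
  adds 2 min(P, b) + max(b - c, 0), and the minimum completes 2 max(b - P, 0) to 2 b; hence
  \<open>\<alpha> + 2\<close> and the index \<open>Suc c\<close>.\<close>

lemma W_next:
  assumes "P + c = k"
  shows "W \<alpha> \<beta> P (Suc P) = yv * zv ^ P * qv ^ (\<alpha> * P + \<beta>) * G (\<alpha> + 2) \<beta> (Suc c) (Suc k)"
proof -
  have "W \<alpha> \<beta> P (Suc P) = yv * zv ^ P * qv ^ (\<alpha> * P + \<beta> + (Suc P - Suc P) + (Suc P - Suc P)) * G (\<alpha> + 2) \<beta> (Suc c) (Suc k)"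
    unfolding wser_def
    by (rule gser_step) (use assms in \<open>auto simp: distinct_charges set_charges Bn_def algebra_simps\<close>)
  then show ?thesis by simp
qed

text \<open>Only the charge k distinguishes the indices \<open>Suc k\<close> and \<open>k\<close>,
  and row k of \<open>Bn\<close> is 3 b.\<close>

lemma G_top:
  assumes "P + c = k"
  shows "G \<alpha> \<beta> (Suc P) (Suc k) - G \<alpha> \<beta> (Suc P) k
    = yv * zv ^ k * qv ^ (\<alpha> * k + \<beta> + c) * G (\<alpha> + 3) \<beta> (Suc P) (Suc k)"
proof -
  have "G \<alpha> \<beta> (Suc P) (Suc k) - G \<alpha> \<beta> (Suc P) k
    = yv * zv ^ k * qv ^ (\<alpha> * k + \<beta> + (Suc k - Suc P) + (Suc k - Suc k)) * G (\<alpha> + 3) \<beta> (Suc P) (Suc k)"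
    by (rule gser_step) (use assms in \<open>auto simp: distinct_charges set_charges Bn_def algebra_simps\<close>)
  moreover have "\<alpha> * k + \<beta> + (Suc k - Suc P) + (Suc k - Suc k) = \<alpha> * k + \<beta> + c"
    using assms by simp
  ultimately show ?thesis by (simp only:)
qed

text \<open>The second terms of the two \<open>wser\<close> cancel. The remaining linear terms
  differ only at the charge 0, whose row of \<open>Bn\<close> vanishes, so the step reproduces the
  same series.\<close>

lemma R_zero: "R \<alpha> \<beta> 0 (Suc t) = qv ^ \<beta> * yv * G \<alpha> \<beta> 1 (Suc t)"
proof -
  have "G \<alpha> \<beta> 0 (Suc (Suc t)) = G \<alpha> (Suc \<beta>) 1 (Suc (Suc t))"
    by (rule gser_cong) simp
  then have "R \<alpha> \<beta> 0 (Suc t) = G \<alpha> \<beta> 1 (Suc t) - G \<alpha> (Suc \<beta>) 2 (Suc t)"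
    by (simp add: dser_def wser_def numeral_2_eq_2)
  also have "\<dots> = yv * zv ^ 0 * qv ^ (\<alpha> * 0 + \<beta> + (Suc 0 - 1) + (Suc 0 - Suc t)) * G \<alpha> \<beta> 1 (Suc t)"
    by (rule gser_step) (auto simp: distinct_charges set_charges Bn_def algebra_simps)
  finally show ?thesis by (simp add: mult_ac)
qed

text \<open>Once the indices 0 and 1 are absorbed into \<alpha> and \<beta>, both sides are the same
  combination of four series.\<close>

lemma wrel_p0: "W \<alpha> \<beta> 0 (Suc c) - W \<alpha> \<beta> 0 c = R (Suc \<alpha>) \<beta> c (Suc k)"
proof -
  have *: "set (charges k) \<subseteq> {..k}" by (auto simp: set_charges)
  show ?thesis
    by (simp add: dser_def wser_def gser_0[OF *] gser_Suc_0[OF *] gser_beyond[OF *] gser_commute[of _ _ _ _ "Suc k"])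
qed

lemma wrel_c0:
  assumes "p + b = k"
  shows "W \<alpha> \<beta> p (Suc p) - W \<alpha> \<beta> p p = qv ^ (\<alpha> * p) * zv ^ p * R (Suc \<alpha>) \<beta> 0 (Suc b)"
proof -
  have *: "set (charges k) \<subseteq> {..k}" by (auto simp: set_charges)
  show ?thesis
    by (simp add: W_next[OF assms] wser_diag R_zero gser_Suc_0[OF *] gser_commute[of _ _ _ _ _ "Suc k"] power_add mult_ac)
qed

lemma R_next: "R \<alpha> \<beta> p (Suc p) = W \<alpha> \<beta> p (Suc p)"
  by (simp add: dser_def wser_diag)

text \<open>A step at the charge k on the left and a step at the charge c on the right lead to the
  same series.\<close>

lemma wrel_b0:
  assumes "p + c = k"
  shows "W \<alpha> \<beta> p (Suc k) - W \<alpha> \<beta> p k = qv ^ (\<alpha> * p) * zv ^ p * R (Suc \<alpha>) \<beta> c (Suc c)"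
proof -
  have cp: "c + p = k" using assms by simp
  have "G \<alpha> \<beta> p (Suc (Suc k)) = G \<alpha> \<beta> p (Suc k)"
    by (rule gser_cong) (auto simp: set_charges)
  then have "W \<alpha> \<beta> p (Suc k) - W \<alpha> \<beta> p k = G \<alpha> \<beta> (Suc p) (Suc k) - G \<alpha> \<beta> (Suc p) k"
    by (simp add: wser_def)
  also have "\<dots> = qv ^ (\<alpha> * p) * zv ^ p * R (Suc \<alpha>) \<beta> c (Suc c)"
    unfolding R_next W_next[OF cp] G_top[OF assms]
    by (simp add: power_add algebra_simps numeral_3_eq_3 flip: assms)
  finally show ?thesis .
qed

lemma drel_p0:
  assumes "Suc c + b = k"
  shows "R \<alpha> \<beta> 0 (Suc (Suc c)) - R \<alpha> \<beta> 0 (Suc c) =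
     qv ^ \<beta> * yv * (W (Suc \<alpha>) \<beta> (Suc c) k
       + qv ^ (\<alpha> * Suc c + Suc c) * zv ^ Suc c * W (\<alpha> + 2) \<beta> b (Suc b))"
proof -
  have *: "set (charges k) \<subseteq> {..k}" by (auto simp: set_charges)
  have bc: "b + Suc c = k" using assms by simp
  have "R \<alpha> \<beta> 0 (Suc (Suc c)) - R \<alpha> \<beta> 0 (Suc c)
     = qv ^ \<beta> * yv * (G (Suc \<alpha>) \<beta> (Suc (Suc c)) (Suc k) - G (Suc \<alpha>) \<beta> (Suc c) (Suc k))"
    by (simp add: R_zero gser_Suc_0[OF *] gser_commute[of _ _ _ _ "Suc k"] right_diff_distrib)
  \<comment> \<open>Inserting an intermediate term splits the difference into a \<open>wser\<close>
    and a step at the highest charge.\<close>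
  also have "\<dots> = qv ^ \<beta> * yv * (W (Suc \<alpha>) \<beta> (Suc c) k
       + (G (Suc \<alpha>) \<beta> (Suc (Suc c)) (Suc k) - G (Suc \<alpha>) \<beta> (Suc (Suc c)) k))"
    by (simp add: wser_def)
  also have "G (Suc \<alpha>) \<beta> (Suc (Suc c)) (Suc k) - G (Suc \<alpha>) \<beta> (Suc (Suc c)) k
     = qv ^ (\<alpha> * Suc c + Suc c) * zv ^ Suc c * W (\<alpha> + 2) \<beta> b (Suc b)"
    unfolding G_top[OF assms] W_next[OF bc]
    by (simp add: power_add algebra_simps numeral_3_eq_3 numeral_2_eq_2 flip: assms)
  finally show ?thesis .
qed

text \<open>The difference of two instances of \<open>wrel_b0\<close>, at p and p + 1. The first
  summand of \<open>drel\<close> is absent because for b = 0 its two indices coincide and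
  \<open>wser_diag\<close> applies.\<close>

lemma drel_b0:
  assumes "p + Suc c = k"
  shows "R \<alpha> \<beta> p (Suc k) - R \<alpha> \<beta> p k =
     qv ^ \<beta> * yv * (qv ^ (\<alpha> * k + Suc c) * zv ^ k * W (\<alpha> + 2) \<beta> 0 (Suc p))"
proof -
  have *: "set (charges k) \<subseteq> {..k}" by (auto simp: set_charges)
  have 1: "Suc p + c = k" "c + Suc p = k" "Suc c + p = k" using assms by auto
  have "R \<alpha> \<beta> p (Suc k) - R \<alpha> \<beta> p k
     = (W \<alpha> \<beta> p (Suc k) - W \<alpha> \<beta> p k) - (W \<alpha> (Suc \<beta>) (Suc p) (Suc k) - W \<alpha> (Suc \<beta>) (Suc p) k)"
    by (simp add: dser_def)
  also have "\<dots> = qv ^ (\<alpha> * p) * zv ^ p * W (Suc \<alpha>) \<beta> (Suc c) (Suc (Suc c))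
       - qv ^ (\<alpha> * Suc p) * zv ^ Suc p * W (Suc \<alpha>) (Suc \<beta>) c (Suc c)"
    by (simp only: wrel_b0[OF assms] wrel_b0[OF 1(1)] R_next)
  also have "\<dots> = qv ^ \<beta> * yv * (qv ^ (\<alpha> * k + Suc c) * zv ^ k *
      (G (\<alpha> + 3) \<beta> (Suc p) (Suc k) - G (\<alpha> + 3) (Suc \<beta>) (Suc (Suc p)) (Suc k)))"
    unfolding W_next[OF 1(2)] W_next[OF 1(3)]
    by (simp add: power_add algebra_simps numeral_3_eq_3 numeral_2_eq_2 flip: assms)
  also have "G (\<alpha> + 3) \<beta> (Suc p) (Suc k) - G (\<alpha> + 3) (Suc \<beta>) (Suc (Suc p)) (Suc k) = W (\<alpha> + 2) \<beta> 0 (Suc p)"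
    by (simp add: wser_def gser_0[OF *] gser_Suc_0[OF *] gser_commute[of _ _ _ _ "Suc k"] numeral_3_eq_3)
  finally show ?thesis .
qed

end

section \<open>Raising the charges and adjoining the highest one\<close>

lemma gser_map_Suc:
  "gser (Suc (Suc k)) (map Suc as) \<alpha> \<beta> (Suc P) (Suc T) = raise_charges (gser k as \<alpha> (\<alpha> + \<beta>) P T)"
  using fser_map_Suc[of k as] by (simp add: gser_def add_ac)

lemma wser_map_Suc:
  "wser (Suc (Suc k)) (map Suc as) \<alpha> \<beta> (Suc p) (Suc t) = raise_charges (wser k as \<alpha> (\<alpha> + \<beta>) p t)"
  by (simp add: wser_def gser_map_Suc raise_charges_diff)

lemma dser_map_Suc:
  "dser (Suc (Suc k)) (map Suc as) \<alpha> \<beta> (Suc p) (Suc t) = raise_charges (dser k as \<alpha> (\<alpha> + \<beta>) p t)"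
  by (simp add: dser_def wser_map_Suc raise_charges_diff)

lemma raise_charges_yv_wser: "raise_charges (yv * wser N as \<alpha> \<beta> p t) = yv * zv * raise_charges (wser N as \<alpha> (\<beta> + 2) p t)"
proof -
  have "(\<lambda>b. \<alpha> * b + \<beta> + (Suc b - P) + (Suc b - S) + 2) = (\<lambda>b. \<alpha> * b + (\<beta> + 2) + (Suc b - P) + (Suc b - S))"
    for P S by auto
  then have "raise_charges (yv * gser N as \<alpha> \<beta> P S) = yv * zv * raise_charges (gser N as \<alpha> (\<beta> + 2) P S)" for P S
    unfolding gser_def raise_charges_yv_fser by simp
  then show ?thesis by (simp add: wser_def right_diff_distrib raise_charges_diff)
qed

text \<open>For a difference in which the exponent of the outer charge and the inner series change
  together: the inner difference, plus a term with one particle of the outer charge removed.\<close>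

lemma msum_sub:
  "msum a c e f - msum a c (Suc e) g
    = msum a c (Suc e) (\<lambda>m. f m - g m) + yv * zv ^ a * qv ^ e * msum a c (e + c) (\<lambda>m. f (Suc m))"
  unfolding msum_diff msum_step[symmetric] by simp

text \<open>Iterating the assumption makes each member of the family divisible by every power of
  y.\<close>

lemma fps_eq_0_by_yv_descent:
  fixes f :: "nat \<Rightarrow> ser3"
  assumes "\<And>i. f i = yv * g i * f (h i)"
  shows "f i = 0"
proof -
  have "f i $ M = 0" for i M
  proof (induction M arbitrary: i rule: less_induct)
    case (less M)
    show ?case
    proof (cases M)
      case 0
      then show ?thesis by (subst assms) (simp add: yv_def)
    next
      case (Suc M')
      have "f i $ M = (g i * f (h i)) $ M'"
        by (subst assms) (simp add: yv_nth mult.assoc Suc)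
      also have "\<dots> = (\<Sum>j=0..M'. g i $ j * f (h i) $ (M' - j))"
        by (simp add: fps_mult_nth)
      also have "\<dots> = 0"
        using less Suc by (intro sum.neutral) auto
      finally show ?thesis .
    qed
  qed
  then show ?thesis by (intro fps_ext) simp
qed

context
  fixes k :: nat
begin

private abbreviation "K \<equiv> Suc (Suc k)"
private abbreviation "Wm \<equiv> wser K (map Suc (charges k))"
private abbreviation "Dm \<equiv> dser K (map Suc (charges k))"
private abbreviation "Wt \<equiv> wser K (K # map Suc (charges k))"
private abbreviation "Dt \<equiv> dser K (K # map Suc (charges k))"

text \<open>This is \<open>raise_charges\<close> applied to \<open>wrel k\<close>. Raising turns
  \<alpha> b into \<alpha> (b + 1); as \<alpha> grows by one on the right of \<open>wrel\<close>,
  the two sides end up with different \<beta>.\<close>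

lemma wrel_mid:
  assumes "wrel k" "p + Suc c + Suc b = K"
  shows "Wm \<alpha> (Suc \<beta>) (Suc p) (Suc (p + Suc c)) - Wm \<alpha> (Suc \<beta>) (Suc p) (p + Suc c)
    = qv ^ (\<alpha> * p) * (zv ^ p * Dm (Suc \<alpha>) \<beta> (Suc c) (Suc b + Suc c))"
proof -
  have "raise_charges (wser k (charges k) \<alpha> (\<alpha> + Suc \<beta>) p (Suc (p + c)) - wser k (charges k) \<alpha> (\<alpha> + Suc \<beta>) p (p + c))
    = raise_charges (qv ^ (\<alpha> * p) * (zv ^ p * dser k (charges k) (Suc \<alpha>) (Suc \<alpha> + \<beta>) c (Suc (b + c))))"
    using assms by (simp add: wrel_def mult.assoc)
  then show ?thesis
    unfolding raise_charges_diff raise_charges_qv raise_charges_zv wser_map_Suc[symmetric] dser_map_Suc[symmetric] by simp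
qed

lemma drel_mid:
  assumes "drel k" "Suc p + Suc c + Suc b = K"
  shows "Dm \<alpha> \<beta> (Suc p) (Suc (Suc p + Suc c)) - Dm \<alpha> \<beta> (Suc p) (Suc p + Suc c)
    = qv ^ \<beta> * (yv * (qv ^ (\<alpha> * Suc p) * (zv ^ Suc p * Wm (Suc \<alpha>) (Suc \<beta>) (Suc (Suc c)) (Suc b + Suc c))
      + qv ^ (\<alpha> * (Suc p + Suc c) + Suc c) * (zv ^ (Suc p + Suc c) * Wm (\<alpha> + 2) \<beta> (Suc b) (Suc b + Suc p))))"
proof -
  have eq: "dser k (charges k) \<alpha> (\<alpha> + \<beta>) p (Suc (p + Suc c)) - dser k (charges k) \<alpha> (\<alpha> + \<beta>) p (p + Suc c) =
     qv ^ (\<alpha> + \<beta> + \<alpha> * p) * (zv ^ p * (yv * wser k (charges k) (Suc \<alpha>) (\<alpha> + \<beta>) (Suc c) (b + Suc c)))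
       + qv ^ (\<alpha> + \<beta> + \<alpha> * (p + Suc c) + Suc c) * (zv ^ (p + Suc c) * (yv * wser k (charges k) (\<alpha> + 2) (\<alpha> + \<beta>) b (Suc (b + p))))"
    using assms(1)[unfolded drel_def, rule_format, of p c b \<alpha> "\<alpha> + \<beta>"] assms(2)
    by (simp add: power_add algebra_simps)
  have "raise_charges (dser k (charges k) \<alpha> (\<alpha> + \<beta>) p (Suc (p + Suc c)) - dser k (charges k) \<alpha> (\<alpha> + \<beta>) p (p + Suc c)) =
     qv ^ (\<alpha> + \<beta> + \<alpha> * p) * (zv ^ p * (yv * zv * raise_charges (wser k (charges k) (Suc \<alpha>) (Suc \<alpha> + Suc \<beta>) (Suc c) (b + Suc c))))
       + qv ^ (\<alpha> + \<beta> + \<alpha> * (p + Suc c) + Suc c) * (zv ^ (p + Suc c) * (yv * zv * raise_charges (wser k (charges k) (\<alpha> + 2) (\<alpha> + 2 + \<beta>) b (Suc (b + p)))))"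
    unfolding eq raise_charges_add raise_charges_qv raise_charges_zv raise_charges_yv_wser by (simp add: add_ac)
  then show ?thesis
    unfolding raise_charges_diff wser_map_Suc[symmetric] dser_map_Suc[symmetric]
    by (simp add: power_add algebra_simps)
qed

text \<open>Both terms of \<open>wser\<close> have the same coefficient e at the charge K; the
  bounds on p and t prevent truncation there. Row K of \<open>Bn\<close> is 3 b, so m particles of
  charge K raise \<alpha> by 3 m.\<close>

lemma Wt_msum:
  assumes "p \<le> K" "t \<le> K" "e = \<alpha> * K + \<beta> + (K - p) + (Suc K - t)"
  shows "Wt \<alpha> \<beta> p t = msum K (3 * K) e (\<lambda>m. Wm (\<alpha> + 3 * m) \<beta> p t)"
proof -
  have G: "gser K (K # map Suc (charges k)) \<alpha> \<beta> P S =
     msum K (3 * K) (\<alpha> * K + \<beta> + (Suc K - P) + (Suc K - S)) (\<lambda>m. gser K (map Suc (charges k)) (\<alpha> + 3 * m) \<beta> P S)" for P S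
  proof -
    have "fser K (map Suc (charges k)) (\<lambda>b. \<alpha> * b + \<beta> + (Suc b - P) + (Suc b - S) + m * Bn K K b)
       = gser K (map Suc (charges k)) (\<alpha> + 3 * m) \<beta> P S" for m
      unfolding gser_def by (rule fser_cong) (auto simp: set_charges Bn_def algebra_simps)
    moreover have "Bn K K K = 3 * K" by (simp add: Bn_def)
    ultimately show ?thesis by (simp add: gser_def)
  qed
  have "Suc K - Suc p = K - p" "Suc K - p = Suc (K - p)" "Suc K - Suc t = K - t" "Suc K - t = Suc (K - t)"
    using assms by auto
  then show ?thesis unfolding wser_def G msum_diff assms(3) by (simp add: add_ac)
qed

lemma Dt_msum:
  assumes "p < K" "t \<le> K" "e = \<alpha> * K + \<beta> + (K - p) + (Suc K - t)"
  shows "Dt \<alpha> \<beta> p t = msum K (3 * K) e (\<lambda>m. Dm (\<alpha> + 3 * m) \<beta> p t)"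
  unfolding dser_def msum_diff
  by (subst Wt_msum[where e = e], use assms in simp_all)
     (subst Wt_msum[where e = e], use assms in simp_all)

text \<open>This is \<open>wrel_mid\<close> summed over the multiplicity of the charge K. Lowering
  the last index raises e to e + 1, and by \<open>msum_sub\<close> this leaves the extra last
  term.\<close>

lemma wrel_top:
  assumes "wrel k" "p + Suc c + Suc b = K" "e = \<alpha> * K + \<beta> + 2 * Suc b + Suc c"
  shows "Wt \<alpha> (Suc \<beta>) (Suc p) (Suc (p + Suc c)) - Wt \<alpha> (Suc \<beta>) (Suc p) (p + Suc c)
    = qv ^ (\<alpha> * p) * zv ^ p * Dt (Suc \<alpha>) \<beta> (Suc c) (Suc b + Suc c)
      + yv * zv ^ K * qv ^ e * Wt (\<alpha> + 3) (Suc \<beta>) (Suc p) (Suc (p + Suc c))"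
proof -
  have 1: "Wt \<alpha> (Suc \<beta>) (Suc p) (Suc (p + Suc c))
     = msum K (3 * K) e (\<lambda>m. Wm (\<alpha> + 3 * m) (Suc \<beta>) (Suc p) (Suc (p + Suc c)))"
    if "e = \<alpha> * K + \<beta> + 2 * Suc b + Suc c" for \<alpha> e
    by (rule Wt_msum) (use assms that in auto)
  have 2: "Wt \<alpha> (Suc \<beta>) (Suc p) (p + Suc c)
     = msum K (3 * K) (Suc e) (\<lambda>m. Wm (\<alpha> + 3 * m) (Suc \<beta>) (Suc p) (p + Suc c))"
    by (rule Wt_msum) (use assms in auto)
  have 3: "Wt (\<alpha> + 3) (Suc \<beta>) (Suc p) (Suc (p + Suc c))
     = msum K (3 * K) (e + 3 * K) (\<lambda>m. Wm (\<alpha> + 3 * Suc m) (Suc \<beta>) (Suc p) (Suc (p + Suc c)))"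
    by (subst 1[where e = "e + 3 * K"]) (use assms in \<open>simp_all add: algebra_simps\<close>)
  have 4: "Dt (Suc \<alpha>) \<beta> (Suc c) (Suc b + Suc c)
     = msum K (3 * K) (Suc e + 3 * p) (\<lambda>m. Dm (Suc \<alpha> + 3 * m) \<beta> (Suc c) (Suc b + Suc c))"
    by (rule Dt_msum) (use assms in \<open>auto simp: algebra_simps\<close>)
  have "qv ^ ((\<alpha> + 3 * m) * p) = qv ^ (\<alpha> * p + 3 * p * m)" for m
    by (simp add: algebra_simps)
  then have 5: "Wm (\<alpha> + 3 * m) (Suc \<beta>) (Suc p) (Suc (p + Suc c)) - Wm (\<alpha> + 3 * m) (Suc \<beta>) (Suc p) (p + Suc c)
    = qv ^ (\<alpha> * p + 3 * p * m) * (zv ^ p * Dm (Suc \<alpha> + 3 * m) \<beta> (Suc c) (Suc b + Suc c))" for m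
    using wrel_mid[OF assms(1,2), of "\<alpha> + 3 * m" \<beta>] by simp
  show ?thesis
    unfolding 1[OF assms(3)] 2 3 4 msum_sub 5 msum_qv msum_zv by (simp add: mult.assoc)
qed

lemma drel_top:
  assumes "drel k" "Suc p + Suc c + Suc b = K" "e = \<alpha> * K + \<beta> + 2 * Suc b + Suc c"
  shows "Dt \<alpha> \<beta> (Suc p) (Suc (Suc p + Suc c)) - Dt \<alpha> \<beta> (Suc p) (Suc p + Suc c)
    = qv ^ \<beta> * (yv * (qv ^ (\<alpha> * Suc p) * (zv ^ Suc p * Wt (Suc \<alpha>) (Suc \<beta>) (Suc (Suc c)) (Suc b + Suc c))
      + qv ^ (\<alpha> * (Suc p + Suc c) + Suc c) * (zv ^ (Suc p + Suc c) * Wt (\<alpha> + 2) \<beta> (Suc b) (Suc b + Suc p))))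
      + yv * zv ^ K * qv ^ e * Dt (\<alpha> + 3) \<beta> (Suc p) (Suc (Suc p + Suc c))"
proof -
  have 1: "Dt \<alpha> \<beta> (Suc p) (Suc (Suc p + Suc c))
     = msum K (3 * K) e (\<lambda>m. Dm (\<alpha> + 3 * m) \<beta> (Suc p) (Suc (Suc p + Suc c)))"
    if "e = \<alpha> * K + \<beta> + 2 * Suc b + Suc c" for \<alpha> e
    by (rule Dt_msum) (use assms that in auto)
  have 2: "Dt \<alpha> \<beta> (Suc p) (Suc p + Suc c)
     = msum K (3 * K) (Suc e) (\<lambda>m. Dm (\<alpha> + 3 * m) \<beta> (Suc p) (Suc p + Suc c))"
    by (rule Dt_msum) (use assms in auto)
  have 3: "Dt (\<alpha> + 3) \<beta> (Suc p) (Suc (Suc p + Suc c))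
     = msum K (3 * K) (e + 3 * K) (\<lambda>m. Dm (\<alpha> + 3 * Suc m) \<beta> (Suc p) (Suc (Suc p + Suc c)))"
    by (subst 1[where e = "e + 3 * K"]) (use assms in \<open>simp_all add: algebra_simps\<close>)
  have 4: "Wt (Suc \<alpha>) (Suc \<beta>) (Suc (Suc c)) (Suc b + Suc c)
     = msum K (3 * K) (Suc e + 3 * Suc p) (\<lambda>m. Wm (Suc \<alpha> + 3 * m) (Suc \<beta>) (Suc (Suc c)) (Suc b + Suc c))"
    by (rule Wt_msum) (use assms in \<open>auto simp: algebra_simps\<close>)
  have 5: "Wt (\<alpha> + 2) \<beta> (Suc b) (Suc b + Suc p)
     = msum K (3 * K) (Suc e + 3 * (Suc p + Suc c)) (\<lambda>m. Wm (\<alpha> + 2 + 3 * m) \<beta> (Suc b) (Suc b + Suc p))"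
    by (rule Wt_msum) (use assms in \<open>auto simp: algebra_simps\<close>)
  have q1: "qv ^ ((\<alpha> + 3 * m) * Suc p) = qv ^ (\<alpha> * Suc p + 3 * Suc p * m)" for m
    by (rule arg_cong[where f = "\<lambda>i. qv ^ i"]) (simp add: algebra_simps)
  have q2: "qv ^ ((\<alpha> + 3 * m) * (Suc p + Suc c) + Suc c)
     = qv ^ (\<alpha> * (Suc p + Suc c) + Suc c + 3 * (Suc p + Suc c) * m)" for m
    by (rule arg_cong[where f = "\<lambda>i. qv ^ i"]) (simp add: algebra_simps)
  \<comment> \<open>The exponent is padded with a zero multiple of m so that it has the shape
    required by \<open>msum_qv\<close>.\<close>
  have q3: "qv ^ \<beta> * x = qv ^ (\<beta> + 0 * m) * x" for m x by simp
  have 6: "Dm (\<alpha> + 3 * m) \<beta> (Suc p) (Suc (Suc p + Suc c)) - Dm (\<alpha> + 3 * m) \<beta> (Suc p) (Suc p + Suc c)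
    = qv ^ (\<beta> + 0 * m) * (yv * (qv ^ (\<alpha> * Suc p + 3 * Suc p * m) * (zv ^ Suc p * Wm (Suc \<alpha> + 3 * m) (Suc \<beta>) (Suc (Suc c)) (Suc b + Suc c))
      + qv ^ (\<alpha> * (Suc p + Suc c) + Suc c + 3 * (Suc p + Suc c) * m) * (zv ^ (Suc p + Suc c) * Wm (\<alpha> + 2 + 3 * m) \<beta> (Suc b) (Suc b + Suc p))))" for m
    using drel_mid[OF assms(1,2), of "\<alpha> + 3 * m" \<beta>] unfolding q1 q2 by (simp add: add_ac)
  show ?thesis
    unfolding 1[OF assms(3)] 2 3 4 5 msum_sub 6 msum_qv msum_yv msum_add msum_zv by simp
qed

section \<open>The defects of the two identities at k + 2\<close>

context
  assumes wrel: "wrel k" and drel: "drel k"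
begin

text \<open>What remains of \<open>dser\<close> when the factor of the charge 0 is divided out: its
  second term has \<beta> + 1, whose factor differs from that of \<beta> by 1 - q^\<beta> y.\<close>

definition Rt where
  "Rt \<alpha> \<beta> p t = Dt \<alpha> \<beta> p t + qv ^ \<beta> * yv * Wt \<alpha> (Suc \<beta>) (Suc p) t"

definition wdefect where
  "wdefect \<beta> p c b \<alpha> = Wt \<alpha> \<beta> p (Suc (p + c)) - Wt \<alpha> \<beta> p (p + c)
     - qv ^ (\<alpha> * p) * zv ^ p * Rt (Suc \<alpha>) \<beta> c (Suc (b + c))"

definition ddefect where
  "ddefect \<beta> p c b \<alpha> = Rt \<alpha> \<beta> p (Suc (p + c)) - Rt \<alpha> \<beta> p (p + c)
     - qv ^ \<beta> * yv * (qv ^ (\<alpha> * p) * zv ^ p * Wt (Suc \<alpha>) \<beta> c (b + c)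
       + qv ^ (\<alpha> * (p + c) + c) * zv ^ (p + c) * Wt (\<alpha> + 2) \<beta> b (Suc (b + p)))"

lemma Wt_split: "Wt \<alpha> \<beta> p t = Dt \<alpha> \<beta> p t + Wt \<alpha> (Suc \<beta>) (Suc p) t"
  by (simp add: dser_def)

text \<open>By \<open>Wt_split\<close> this is the sum of \<open>drel_top\<close> and
  \<open>wrel_top\<close>; the \<open>Dt\<close> term of one and the first \<open>Wt\<close> term of
  the other combine to \<open>Rt\<close>.\<close>

lemma Wt_difference:
  assumes "Suc p + Suc c + Suc b = K"
  shows "Wt \<alpha> \<beta> (Suc p) (Suc (Suc p + Suc c)) - Wt \<alpha> \<beta> (Suc p) (Suc p + Suc c)
    = qv ^ (\<alpha> * Suc p) * zv ^ Suc p * Rt (Suc \<alpha>) \<beta> (Suc c) (Suc b + Suc c)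
      + qv ^ \<beta> * yv * (qv ^ (\<alpha> * (Suc p + Suc c) + Suc c) * zv ^ (Suc p + Suc c) * Wt (\<alpha> + 2) \<beta> (Suc b) (Suc b + Suc p))
      + yv * zv ^ K * qv ^ (\<alpha> * K + \<beta> + 2 * Suc b + Suc c) * Wt (\<alpha> + 3) \<beta> (Suc p) (Suc (Suc p + Suc c))"
  using wrel_top[OF wrel assms refl, of \<alpha> \<beta>] drel_top[OF drel assms refl, of \<alpha> \<beta>]
  unfolding Wt_split[of \<alpha> \<beta> "Suc p"] Wt_split[of "\<alpha> + 3" \<beta> "Suc p"] Rt_def
  by (simp add: algebra_simps)

text \<open>Here \<open>wrel_top\<close> enters with the factor q^\<beta> y, and the same two terms
  combine to \<open>Wt\<close> by \<open>Wt_split\<close>.\<close>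

lemma Rt_difference:
  assumes "Suc p + Suc c + Suc b = K"
  shows "Rt \<alpha> \<beta> (Suc p) (Suc (Suc p + Suc c)) - Rt \<alpha> \<beta> (Suc p) (Suc p + Suc c)
    = qv ^ \<beta> * yv * (qv ^ (\<alpha> * Suc p) * zv ^ Suc p * Wt (Suc \<alpha>) \<beta> (Suc c) (Suc b + Suc c)
       + qv ^ (\<alpha> * (Suc p + Suc c) + Suc c) * zv ^ (Suc p + Suc c) * Wt (\<alpha> + 2) \<beta> (Suc b) (Suc b + Suc p))
      + yv * zv ^ K * qv ^ (\<alpha> * K + \<beta> + 2 * Suc b + Suc c) * Rt (\<alpha> + 3) \<beta> (Suc p) (Suc (Suc p + Suc c))"
proof -
  let ?E = "\<alpha> * K + \<beta> + 2 * Suc b + Suc c"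
  have "Rt \<alpha> \<beta> (Suc p) (Suc (Suc p + Suc c)) - Rt \<alpha> \<beta> (Suc p) (Suc p + Suc c)
    = (Dt \<alpha> \<beta> (Suc p) (Suc (Suc p + Suc c)) - Dt \<alpha> \<beta> (Suc p) (Suc p + Suc c))
     + qv ^ \<beta> * yv * (Wt \<alpha> (Suc \<beta>) (Suc (Suc p)) (Suc (Suc p + Suc c)) - Wt \<alpha> (Suc \<beta>) (Suc (Suc p)) (Suc p + Suc c))"
    by (simp add: Rt_def algebra_simps)
  then show ?thesis
    unfolding wrel_top[OF wrel assms refl] drel_top[OF drel assms refl]
      Wt_split[of "Suc \<alpha>" \<beta> "Suc c"] Rt_def
    by (simp add: algebra_simps)
qed

text \<open>Each family turns into the other one under the rotation \<open>(p, c, b) \<mapsto> (c, b, p)\<close>, so going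
  around twice expresses a defect as a multiple of itself.\<close>

lemma wdefect_rotate:
  assumes "Suc p + Suc c + Suc b = K"
  shows "wdefect \<beta> (Suc p) (Suc c) (Suc b) \<alpha>
    = - (qv ^ (\<alpha> * Suc p) * zv ^ Suc p) * ddefect \<beta> (Suc c) (Suc b) (Suc p) (Suc \<alpha>)"
proof -
  have K: "K = Suc p + Suc c + Suc b" using assms by simp
  have "qv ^ (\<alpha> * K + \<beta> + 2 * Suc b + Suc c) = qv ^ (\<beta> + \<alpha> * Suc p + (Suc \<alpha> * (Suc c + Suc b) + Suc b))"
    by (rule arg_cong[where f = "\<lambda>i. qv ^ i"]) (simp add: K algebra_simps)
  then have e: "qv ^ (\<alpha> * K + \<beta> + 2 * Suc b + Suc c) = qv ^ \<beta> * qv ^ (\<alpha> * Suc p) * qv ^ (Suc \<alpha> * (Suc c + Suc b) + Suc b)"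
    by (simp only: power_add)
  have e': "zv ^ K = zv ^ Suc p * zv ^ (Suc c + Suc b)"
    "qv ^ (\<alpha> * (Suc p + Suc c) + Suc c) = qv ^ (\<alpha> * Suc p) * qv ^ (Suc \<alpha> * Suc c)"
    "zv ^ (Suc p + Suc c) = zv ^ Suc p * zv ^ Suc c"
    "\<alpha> + 3 = Suc \<alpha> + 2" "\<alpha> + 2 = Suc (Suc \<alpha>)"
    unfolding K by (simp_all only: power_add[symmetric], simp_all add: algebra_simps)
  have i: "Suc (Suc b + Suc c) = Suc (Suc c + Suc b)" "Suc b + Suc c = Suc c + Suc b"
    "Suc b + Suc p = Suc p + Suc b" by simp_all
  show ?thesis
    unfolding wdefect_def ddefect_def Wt_difference[OF assms] e e' i by algebra
qed

text \<open>This rotation runs the other way, from (p, c, b) to (b, p, c), so after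
  \<open>wdefect_rotate\<close> it returns to the original triple with \<alpha> + 3. It also
  supplies the factor y.\<close>

lemma ddefect_rotate:
  assumes "Suc p + Suc c + Suc b = K"
  shows "ddefect \<beta> (Suc p) (Suc c) (Suc b) \<alpha>
    = - (qv ^ \<beta> * yv * qv ^ (\<alpha> * (Suc p + Suc c) + Suc c) * zv ^ (Suc p + Suc c)) * wdefect \<beta> (Suc b) (Suc p) (Suc c) (\<alpha> + 2)"
proof -
  have K: "K = Suc p + Suc c + Suc b" using assms by simp
  have "qv ^ (\<alpha> * K + \<beta> + 2 * Suc b + Suc c) = qv ^ (\<beta> + (\<alpha> * (Suc p + Suc c) + Suc c) + (\<alpha> + 2) * Suc b)"
    by (rule arg_cong[where f = "\<lambda>i. qv ^ i"]) (simp add: K algebra_simps)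
  then have e: "qv ^ (\<alpha> * K + \<beta> + 2 * Suc b + Suc c) = qv ^ \<beta> * qv ^ (\<alpha> * (Suc p + Suc c) + Suc c) * qv ^ ((\<alpha> + 2) * Suc b)"
    by (simp only: power_add)
  have e': "zv ^ K = zv ^ (Suc p + Suc c) * zv ^ Suc b"
    by (simp only: K power_add)
  have i: "Suc (\<alpha> + 2) = \<alpha> + 3" "Suc c + Suc p = Suc p + Suc c" by simp_all
  show ?thesis
    unfolding wdefect_def ddefect_def Rt_difference[OF assms] e e' i by algebra
qed

lemma defects_eq_0:
  assumes "Suc p + Suc c + Suc b = K"
  shows "wdefect \<beta> (Suc p) (Suc c) (Suc b) \<alpha> = 0" "ddefect \<beta> (Suc p) (Suc c) (Suc b) \<alpha> = 0"
proof -
  have w: "wdefect \<beta> (Suc p) (Suc c) (Suc b) \<alpha> = 0"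
    if "Suc p + Suc c + Suc b = K" for p c b \<alpha>
  proof (rule fps_eq_0_by_yv_descent)
    fix \<alpha>
    have r: "Suc c + Suc b + Suc p = K" using that by simp
    \<comment> \<open>The descent runs over \<alpha>, with the triple and \<beta> fixed.\<close>
    show "wdefect \<beta> (Suc p) (Suc c) (Suc b) \<alpha> = yv * (qv ^ (\<alpha> * Suc p) * zv ^ Suc p * (qv ^ \<beta> *
        qv ^ (Suc \<alpha> * (Suc c + Suc b) + Suc b) * zv ^ (Suc c + Suc b)))
        * wdefect \<beta> (Suc p) (Suc c) (Suc b) (Suc \<alpha> + 2)"
      by (subst wdefect_rotate[OF that], subst ddefect_rotate[OF r]) (simp add: mult_ac)
  qed
  have r: "Suc b + Suc p + Suc c = K" using assms by simp
  show "wdefect \<beta> (Suc p) (Suc c) (Suc b) \<alpha> = 0" by (rule w[OF assms])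
  show "ddefect \<beta> (Suc p) (Suc c) (Suc b) \<alpha> = 0"
    by (simp add: ddefect_rotate[OF assms] w[OF r])
qed

end

end

section \<open>Adjoining the charge 0 and the induction\<close>

text \<open>By Euler's identity this is multiplication by 1/(q^\<beta> y)_\<infinity>; as an
  \<open>msum\<close> it inherits the rules for \<open>msum\<close>.\<close>

definition adjoin0 :: "nat \<Rightarrow> ser3 \<Rightarrow> ser3" where
  "adjoin0 \<beta> x = msum 0 0 \<beta> (\<lambda>_. x)"

lemma adjoin0_diff: "adjoin0 \<beta> (x - y) = adjoin0 \<beta> x - adjoin0 \<beta> y"
  by (simp add: adjoin0_def msum_diff)

lemma adjoin0_add: "adjoin0 \<beta> (x + y) = adjoin0 \<beta> x + adjoin0 \<beta> y"
  by (simp add: adjoin0_def msum_add)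

lemma adjoin0_yv: "adjoin0 \<beta> (yv * x) = yv * adjoin0 \<beta> x"
  by (simp add: adjoin0_def msum_yv)

lemma adjoin0_zv: "adjoin0 \<beta> (zv ^ i * x) = zv ^ i * adjoin0 \<beta> x"
  by (simp add: adjoin0_def msum_zv)

lemma adjoin0_qv: "adjoin0 \<beta> (qv ^ i * x) = qv ^ i * adjoin0 \<beta> x"
  using msum_qv[of 0 0 \<beta> i 0 "\<lambda>_. x"] by (simp add: adjoin0_def)

lemma adjoin0_Suc: "adjoin0 (Suc \<beta>) x = adjoin0 \<beta> x - qv ^ \<beta> * (yv * adjoin0 \<beta> x)"
  using msum_step[of 0 0 \<beta> "\<lambda>_. x"] by (simp add: adjoin0_def algebra_simps)

lemma adjoin0_eq_0: "adjoin0 \<beta> x = 0 \<Longrightarrow> x = 0"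
proof (rule fps_ext)
  fix M assume b: "adjoin0 \<beta> x = 0"
  show "x $ M = 0 $ M"
  proof (induction M rule: less_induct)
    case (less M)
    have "0 = adjoin0 \<beta> x $ M" by (simp add: b)
    also have "\<dots> = (\<Sum>m\<le>M. fps_const (qker 0 \<beta> m) * x $ (M - m))"
      by (simp add: adjoin0_def msum_nth)
    also have "\<dots> = (\<Sum>m\<in>{0}. fps_const (qker 0 \<beta> m) * x $ (M - m))"
      using less by (intro sum.mono_neutral_right) auto
    also have "\<dots> = x $ M" by (simp add: qker_def q_factorial_def)
    finally show ?case by simp
  qed
qed

text \<open>Row 0 of \<open>Bn\<close> vanishes on charges up to N, so the charge 0 decouples.
  Positive indices contribute nothing at b = 0, which leaves \<beta> as its linear
  coefficient.\<close>

lemma gser_adjoin0: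
  assumes "set as \<subseteq> {..N}"
  shows "gser N (0 # as) \<alpha> \<beta> (Suc P) (Suc T) = adjoin0 \<beta> (gser N as \<alpha> \<beta> (Suc P) (Suc T))"
proof -
  have "fser N as (\<lambda>b. \<alpha> * b + \<beta> + (b - P) + (b - T) + m * Bn N 0 b) = gser N as \<alpha> \<beta> (Suc P) (Suc T)" for m
    unfolding gser_def by (rule fser_cong) (use assms in \<open>auto simp: Bn_def\<close>)
  then show ?thesis by (simp add: gser_def[of N "0 # as"] adjoin0_def Bn_def)
qed

lemma wser_adjoin0:
  assumes "set as \<subseteq> {..N}"
  shows "wser N (0 # as) \<alpha> \<beta> (Suc p) (Suc t) = adjoin0 \<beta> (wser N as \<alpha> \<beta> (Suc p) (Suc t))"
  by (simp add: wser_def gser_adjoin0[OF assms] adjoin0_diff)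

lemma dser_adjoin0:
  assumes "set as \<subseteq> {..N}"
  shows "dser N (0 # as) \<alpha> \<beta> (Suc p) (Suc t)
    = adjoin0 \<beta> (dser N as \<alpha> \<beta> (Suc p) (Suc t) + qv ^ \<beta> * yv * wser N as \<alpha> (Suc \<beta>) (Suc (Suc p)) (Suc t))"
  by (simp add: dser_def wser_adjoin0[OF assms] adjoin0_Suc adjoin0_diff adjoin0_add adjoin0_qv adjoin0_yv mult.assoc)

text \<open>For positive p, c, b both relations are \<open>adjoin0\<close> applied to vanishing
  defects; the other cases are the boundary identities.\<close>

lemma rel_step:
  assumes "wrel k" "drel k"
  shows "wrel (Suc (Suc k)) \<and> drel (Suc (Suc k))"
proof -
  let ?K = "Suc (Suc k)" and ?E = "Suc (Suc k) # map Suc (charges k)"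
  have E: "set ?E \<subseteq> {..?K}" by (auto simp: set_charges)
  have ch: "charges ?K = 0 # ?E" by simp
  note R = Rt_def[OF assms, symmetric]
  have w: "wser ?K (charges ?K) \<alpha> \<beta> (Suc p) (Suc (Suc p + Suc c)) - wser ?K (charges ?K) \<alpha> \<beta> (Suc p) (Suc p + Suc c) =
     qv ^ (\<alpha> * Suc p) * zv ^ Suc p * dser ?K (charges ?K) (Suc \<alpha>) \<beta> (Suc c) (Suc (Suc b + Suc c))"
    if "Suc p + Suc c + Suc b = ?K" for \<alpha> \<beta> p c b
  proof -
    have "adjoin0 \<beta> (wdefect k \<beta> (Suc p) (Suc c) (Suc b) \<alpha>) = adjoin0 \<beta> 0"
      by (simp only: defects_eq_0[OF assms that])
    moreover have "adjoin0 \<beta> 0 = 0" using adjoin0_diff[of \<beta> 0 0] by simp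
    ultimately show ?thesis
      unfolding ch add_Suc add_Suc_right wser_adjoin0[OF E] dser_adjoin0[OF E] R wdefect_def[OF assms]
      by (simp add: adjoin0_diff adjoin0_qv adjoin0_zv mult.assoc del: power_Suc)
  qed
  have d: "dser ?K (charges ?K) \<alpha> \<beta> (Suc p) (Suc (Suc p + Suc c)) - dser ?K (charges ?K) \<alpha> \<beta> (Suc p) (Suc p + Suc c) =
     qv ^ \<beta> * yv * (qv ^ (\<alpha> * Suc p) * zv ^ Suc p * wser ?K (charges ?K) (Suc \<alpha>) \<beta> (Suc c) (Suc b + Suc c)
       + qv ^ (\<alpha> * (Suc p + Suc c) + Suc c) * zv ^ (Suc p + Suc c) * wser ?K (charges ?K) (\<alpha> + 2) \<beta> (Suc b) (Suc (Suc b + Suc p)))"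
    if "Suc p + Suc c + Suc b = ?K" for \<alpha> \<beta> p c b
  proof -
    have "adjoin0 \<beta> (ddefect k \<beta> (Suc p) (Suc c) (Suc b) \<alpha>) = adjoin0 \<beta> 0"
      by (simp only: defects_eq_0[OF assms that])
    moreover have "adjoin0 \<beta> 0 = 0" using adjoin0_diff[of \<beta> 0 0] by simp
    ultimately show ?thesis
      unfolding ch add_Suc add_Suc_right wser_adjoin0[OF E] dser_adjoin0[OF E] R ddefect_def[OF assms]
      by (simp add: adjoin0_diff adjoin0_add adjoin0_qv adjoin0_zv adjoin0_yv mult.assoc distrib_left del: power_Suc)
  qed
  have "wrel ?K" unfolding wrel_def
  proof (intro allI impI)
    fix \<alpha> \<beta> p c b assume pcb: "p + c + b = ?K"
    consider "p = 0" | "c = 0" | "b = 0" | p' c' b' where "p = Suc p'" "c = Suc c'" "b = Suc b'"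
      using not0_implies_Suc by metis
    then show "wser ?K (charges ?K) \<alpha> \<beta> p (Suc (p + c)) - wser ?K (charges ?K) \<alpha> \<beta> p (p + c) =
       qv ^ (\<alpha> * p) * zv ^ p * dser ?K (charges ?K) (Suc \<alpha>) \<beta> c (Suc (b + c))"
    proof cases
      case 1
      have "b + c = ?K" using pcb 1 by simp
      then show ?thesis unfolding 1 using wrel_p0[of ?K \<alpha> \<beta> c] by simp
    next
      case 2
      show ?thesis unfolding 2 using wrel_c0[of p b ?K \<alpha> \<beta>] pcb 2 by simp
    next
      case 3
      have "p + c = ?K" using pcb 3 by simp
      then show ?thesis unfolding 3 using wrel_b0[of p c ?K \<alpha> \<beta>] by simp
    next
      case 4
      show ?thesis unfolding 4 by (rule w) (use 4 pcb in simp)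
    qed
  qed
  moreover have "drel ?K" unfolding drel_def
  proof (intro allI impI)
    fix \<alpha> \<beta> p c b assume pcb: "p + Suc c + b = ?K"
    consider "p = 0" | "b = 0" | p' b' where "p = Suc p'" "b = Suc b'"
      using not0_implies_Suc by metis
    then show "dser ?K (charges ?K) \<alpha> \<beta> p (Suc (p + Suc c)) - dser ?K (charges ?K) \<alpha> \<beta> p (p + Suc c) =
     qv ^ \<beta> * yv * (qv ^ (\<alpha> * p) * zv ^ p * wser ?K (charges ?K) (Suc \<alpha>) \<beta> (Suc c) (b + Suc c)
       + qv ^ (\<alpha> * (p + Suc c) + Suc c) * zv ^ (p + Suc c) * wser ?K (charges ?K) (\<alpha> + 2) \<beta> b (Suc (b + p)))"
    proof cases
      case 1
      have "Suc c + b = ?K" "b + Suc c = ?K" using pcb 1 by simp_all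
      then show ?thesis unfolding 1 using drel_p0[of c b ?K \<alpha> \<beta>] by (simp del: charges.simps)
    next
      case 2
      have "p + Suc c = ?K" using pcb 2 by simp
      then show ?thesis unfolding 2 using drel_b0[of p c ?K \<alpha> \<beta>]
        by (simp del: charges.simps add: wser_diag[of _ _ _ _ "Suc c"])
    next
      case 3
      show ?thesis unfolding 3 by (rule d) (use 3 pcb in simp)
    qed
  qed
  ultimately show ?thesis ..
qed

text \<open>For k at most 1 no triple has three positive entries, so the boundary identities settle
  the base cases.\<close>

lemma wrel_drel: "wrel k \<and> drel k"
proof (induction k rule: charges.induct)
  case 1
  show ?case unfolding wrel_def drel_def using wrel_p0[of 0] by (auto simp del: charges.simps)
next
  case 2
  have "wser 1 (charges 1) \<alpha> \<beta> p (Suc (p + c)) - wser 1 (charges 1) \<alpha> \<beta> p (p + c) =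
     qv ^ (\<alpha> * p) * zv ^ p * dser 1 (charges 1) (Suc \<alpha>) \<beta> c (Suc (b + c))" if "p + c + b = 1" for \<alpha> \<beta> p c b
  proof (cases "p = 0")
    case True
    with that have "b + c = 1" by simp
    with True show ?thesis using wrel_p0[of 1 \<alpha> \<beta> c] by (simp del: charges.simps)
  next
    case False
    with that have "p = 1" "b = 0" "c = 0" by auto
    then show ?thesis using wrel_b0[of 1 0 1 \<alpha> \<beta>] by (simp del: charges.simps)
  qed
  moreover have "p = 0 \<and> b = 0 \<and> c = 0" if "p + Suc c + b = 1" for p c b :: nat using that by auto
  ultimately show ?case unfolding wrel_def drel_def using drel_p0[of 0 0 1]
    by (auto simp del: charges.simps)
next
  case (3 k)
  then show ?case by (simp only: rel_step)
qed

section \<open>Specialization to \<open>y = 1\<close>\<close>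

text \<open>Particles of positive charge carry at least one z each, so only finitely many powers of
  y occur with a given power of z.\<close>

definition supported :: "ser3 \<Rightarrow> bool" where
  "supported f \<longleftrightarrow> (\<forall>M n. n < M \<longrightarrow> f $ M $ n = 0)"

text \<open>The value at \<open>y = 1\<close>. The bound is \<open>Suc n\<close> and not \<open>n\<close> because \<open>yv * f\<close> need not be supported
  when \<open>f\<close> is.\<close>

definition eval_y1 :: "ser3 \<Rightarrow> rat fps fps" where
  "eval_y1 f = Abs_fps (\<lambda>n. \<Sum>M\<le>Suc n. f $ M $ n)"

definition zscale :: "rat fps fps \<Rightarrow> rat fps fps" where
  "zscale f = Abs_fps (\<lambda>n. fps_X ^ n * f $ n)"

lemma eval_y1_nth: "eval_y1 f $ n = (\<Sum>M\<le>Suc n. f $ M $ n)"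
  by (simp add: eval_y1_def)

lemma zscale_nth: "zscale f $ n = fps_X ^ n * f $ n"
  by (simp add: zscale_def)

lemma zscale_diff: "zscale (f - g) = zscale f - zscale g"
  by (rule fps_ext) (simp add: zscale_nth right_diff_distrib)

lemma zscale_inj: "zscale f = zscale g \<Longrightarrow> f = g"
  by (auto simp: fps_eq_iff[of "zscale f"] fps_eq_iff[of f] zscale_nth)

lemma eval_y1_diff: "eval_y1 (f - g) = eval_y1 f - eval_y1 g"
  by (rule fps_ext) (simp add: eval_y1_nth sum_subtractf)

lemma eval_y1_bound: "supported f \<Longrightarrow> n \<le> N \<Longrightarrow> (\<Sum>M\<le>Suc N. f $ M $ n) = eval_y1 f $ n"
  unfolding eval_y1_nth by (rule sum.mono_neutral_right) (auto simp: supported_def)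

lemma eval_y1_yv: "supported f \<Longrightarrow> eval_y1 (yv * f) = eval_y1 f"
proof (rule fps_ext)
  fix n assume f: "supported f"
  have "eval_y1 (yv * f) $ n = (\<Sum>M\<le>n. f $ M $ n)"
    unfolding eval_y1_nth by (subst sum.atMost_Suc_shift) (simp only: yv_nth, simp)
  also have "\<dots> = eval_y1 f $ n" using f by (simp add: eval_y1_nth supported_def)
  finally show "eval_y1 (yv * f) $ n = eval_y1 f $ n" .
qed

lemma eval_y1_zv: "supported f \<Longrightarrow> eval_y1 (zv ^ p * f) = fps_X ^ p * eval_y1 f"
proof (rule fps_ext)
  fix n assume f: "supported f"
  show "eval_y1 (zv ^ p * f) $ n = (fps_X ^ p * eval_y1 f) $ n"
    using eval_y1_bound[OF f, of "n - p" n] by (simp add: eval_y1_nth[of "zv ^ p * f"] zv_power_nth fps_X_power_mult_nth)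
qed

lemma supported_diff: "supported f \<Longrightarrow> supported g \<Longrightarrow> supported (f - g)"
  by (simp add: supported_def)

lemma msum_nth_nth:
  "msum a c e f $ M $ n = (\<Sum>m\<le>M. if n < a * m then 0 else qker c e m * f m $ (M - m) $ (n - a * m))"
  unfolding msum_nth fps_sum_nth by (rule sum.cong) (simp_all add: fps_X_power_mult_nth mult.assoc)

lemma supported_msum:
  assumes "0 < a" "\<And>m. supported (f m)"
  shows "supported (msum a c e f)"
  unfolding supported_def
proof (intro allI impI)
  fix M n :: nat assume "n < M"
  have am: "m \<le> a * m" for m using assms(1) by simp
  have "n - a * m < M - m" if "\<not> n < a * m" for m
    using \<open>n < M\<close> that am[of m] by arith
  then have "f m $ (M - m) $ (n - a * m) = 0" if "\<not> n < a * m" for m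
    using assms(2) that unfolding supported_def by blast
  then show "msum a c e f $ M $ n = 0" unfolding msum_nth_nth by (intro sum.neutral) simp
qed

lemma eval_y1_msum:
  assumes "0 < a" "\<And>m. supported (f m)"
  shows "eval_y1 (msum a c e f) $ n = (\<Sum>m | a * m \<le> n. qker c e m * eval_y1 (f m) $ (n - a * m))"
proof -
  have am: "m \<le> a * m" for m using assms(1) by simp
  let ?g = "\<lambda>m K. if n < a * m then 0 else qker c e m * f m $ K $ (n - a * m)"
  have "eval_y1 (msum a c e f) $ n = (\<Sum>M\<le>Suc n. \<Sum>m\<le>M. ?g m (M - m))"
    by (simp only: eval_y1_nth msum_nth_nth)
  also have "\<dots> = (\<Sum>(m, K)\<in>{(m, K). m + K \<le> Suc n}. ?g m K)"
    by (rule sum.triangle_reindex_eq[symmetric])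
  also have "{(m, K). m + K \<le> Suc n} = Sigma {..Suc n} (\<lambda>m. {..Suc n - m})"
    by auto
  also have "(\<Sum>(m, K)\<in>Sigma {..Suc n} (\<lambda>m. {..Suc n - m}). ?g m K) = (\<Sum>m\<le>Suc n. \<Sum>K\<le>Suc n - m. ?g m K)"
    by (rule sum.Sigma[symmetric]) auto
  also have "\<dots> = (\<Sum>m | a * m \<le> n. \<Sum>K\<le>Suc n - m. ?g m K)"
    using am by (intro sum.mono_neutral_right) (auto simp: linorder_not_le intro: le_SucI[OF le_trans[OF am]])
  also have "\<dots> = (\<Sum>m | a * m \<le> n. qker c e m * eval_y1 (f m) $ (n - a * m))"
  proof (rule sum.cong[OF refl])
    fix m assume "m \<in> {m. a * m \<le> n}"
    then have m: "a * m \<le> n" "m \<le> n" "n - a * m \<le> n - m"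
      using le_trans[OF am[of m], of n] diff_le_mono2[OF am[of m], of n] by auto
    then have "(\<Sum>K\<le>Suc n - m. ?g m K) = qker c e m * (\<Sum>K\<le>Suc (n - m). f m $ K $ (n - a * m))"
      by (simp add: sum_distrib_left Suc_diff_le del: sum.atMost_Suc)
    \<comment> \<open>The range of K is long enough because n - a m is at most n - m.\<close>
    also have "\<dots> = qker c e m * eval_y1 (f m) $ (n - a * m)"
      by (simp only: eval_y1_bound[OF assms(2) m(3)])
    finally show "(\<Sum>K\<le>Suc n - m. ?g m K) = qker c e m * eval_y1 (f m) $ (n - a * m)" .
  qed
  finally show ?thesis .
qed

lemma supported_fser: "\<forall>a\<in>set as. 0 < a \<Longrightarrow> supported (fser N as u)"
proof (induction as arbitrary: u)
  case Nil
  show ?case by (auto simp: supported_def)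
next
  case (Cons a as)
  then show ?case by (auto intro!: supported_msum)
qed

text \<open>The term b in the linear part counts each particle with its charge, which is its power
  of z.\<close>

lemma fser_zscale_nth: "fser N as (\<lambda>b. u b + b) $ M $ n = fps_X ^ n * fser N as u $ M $ n"
proof (induction as arbitrary: u M n)
  case Nil
  show ?case by (cases M; cases n) auto
next
  case (Cons a as)
  have IH: "fser N as (\<lambda>b. u b + b + m * Bn N a b) $ M $ n = fps_X ^ n * fser N as (\<lambda>b. u b + m * Bn N a b) $ M $ n" for m M n
    using Cons.IH[of "\<lambda>b. u b + m * Bn N a b"] by (simp add: add_ac)
  show ?case
    unfolding fser.simps msum_nth_nth IH sum_distrib_left
  proof (rule sum.cong[OF refl])
    fix m
    let ?x = "fser N as (\<lambda>b. u b + m * Bn N a b) $ (M - m) $ (n - a * m)"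
    have "n = a * m + (n - a * m)" if "\<not> n < a * m" using that by simp
    then have "fps_X ^ n = (fps_X ^ (a * m) * fps_X ^ (n - a * m) :: rat fps)" if "\<not> n < a * m"
      using that by (metis power_add)
    then show "(if n < a * m then 0 else qker (Bn N a a) (u a + a) m * (fps_X ^ (n - a * m) * ?x))
        = fps_X ^ n * (if n < a * m then 0 else qker (Bn N a a) (u a) m * ?x)"
      by (simp add: qker_add)
  qed
qed

lemma fser_nth_0: "fser N as u $ 0 $ 0 = 1"
  by (induction as arbitrary: u) (simp_all add: msum_nth_nth qker_def q_factorial_def choose_two)

lemma eval_y1_fser_zscale: "eval_y1 (fser N as (\<lambda>b. u b + b)) = zscale (eval_y1 (fser N as u))"
  by (rule fps_ext) (simp only: eval_y1_nth zscale_nth fser_zscale_nth sum_distrib_left)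

lemma eval_y1_gser_Suc: "eval_y1 (gser N as (Suc \<alpha>) \<beta> P S) = zscale (eval_y1 (gser N as \<alpha> \<beta> P S))"
proof -
  have "(\<lambda>b. Suc \<alpha> * b + \<beta> + (Suc b - P) + (Suc b - S)) = (\<lambda>b. \<alpha> * b + \<beta> + (Suc b - P) + (Suc b - S) + b)"
    by auto
  then show ?thesis unfolding gser_def by (simp only: eval_y1_fser_zscale)
qed

lemma eval_y1_wser_Suc: "eval_y1 (wser N as (Suc \<alpha>) \<beta> p t) = zscale (eval_y1 (wser N as \<alpha> \<beta> p t))"
  by (simp add: wser_def eval_y1_diff eval_y1_gser_Suc zscale_diff)

section \<open>Uniqueness for the recursion, and its fermionic solution\<close>

lemma zrec_unique:
  fixes U V :: "nat \<Rightarrow> nat \<Rightarrow> rat fps fps"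
  assumes U: "\<And>p c. p + c \<le> k \<Longrightarrow> U p c = (\<Sum>i\<le>c. fps_X ^ p * zscale (U i (k - p - i)))"
    and V: "\<And>p c. p + c \<le> k \<Longrightarrow> V p c = (\<Sum>i\<le>c. fps_X ^ p * zscale (V i (k - p - i)))"
    and init: "U 0 k $ 0 = V 0 k $ 0"
    and pc: "p + c \<le> k"
  shows "U p c = V p c"
proof -
  have main: "p + c \<le> k \<Longrightarrow> U p c $ n = V p c $ n" for p c n
  proof (induction n arbitrary: p c rule: less_induct)
    case (less n)
    have nth: "U p c $ n = (\<Sum>i\<le>c. if n < p then 0 else fps_X ^ (n - p) * U i (k - p - i) $ (n - p))"
      "V p c $ n = (\<Sum>i\<le>c. if n < p then 0 else fps_X ^ (n - p) * V i (k - p - i) $ (n - p))"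
      if "p + c \<le> k" for p c
      by (subst U[OF that], simp only: fps_sum_nth fps_X_power_mult_nth zscale_nth)
         (subst V[OF that], simp only: fps_sum_nth fps_X_power_mult_nth zscale_nth)
    \<comment> \<open>The factor z^p lowers the degree, so the induction hypothesis covers every
      summand.\<close>
    have pos: "U p c $ n = V p c $ n" if "0 < p" "p + c \<le> k" for p c
      unfolding nth[OF that(2)]
    proof (rule sum.cong[OF refl])
      fix i assume "i \<in> {..c}"
      then have "U i (k - p - i) $ (n - p) = V i (k - p - i) $ (n - p)" if "\<not> n < p"
        using that \<open>0 < p\<close> \<open>p + c \<le> k\<close> by (intro less.IH) auto
      then show "(if n < p then 0 else fps_X ^ (n - p) * U i (k - p - i) $ (n - p))
          = (if n < p then 0 else fps_X ^ (n - p) * V i (k - p - i) $ (n - p))" by simp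
    qed
    \<comment> \<open>For p = 0 the degree does not drop, but the summands with i > 0 agree by
      \<open>pos\<close>, and only i = 0 survives. With c = k this gives a factor 1 - q^n, which is
      useless exactly at n = 0, where \<open>init\<close> takes over.\<close>
    have zero: "U 0 c $ n - V 0 c $ n = fps_X ^ n * (U 0 k $ n - V 0 k $ n)" if "c \<le> k" for c
    proof -
      have "U 0 c $ n - V 0 c $ n = (\<Sum>i\<le>c. fps_X ^ n * (U i (k - i) $ n - V i (k - i) $ n))"
        using that by (simp add: nth right_diff_distrib sum_subtractf)
      also have "\<dots> = (\<Sum>i\<in>{0}. fps_X ^ n * (U i (k - i) $ n - V i (k - i) $ n))"
        using that pos by (intro sum.mono_neutral_right) auto
      finally show ?thesis by simp
    qed
    have "U 0 k $ n = V 0 k $ n"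
    proof (cases "n = 0")
      case False
      have "(1 - fps_X ^ n) * (U 0 k $ n - V 0 k $ n) = 0"
        using zero[of k] by (simp add: left_diff_distrib)
      moreover have "(1 - fps_X ^ n :: rat fps) $ 0 \<noteq> 0" using False by simp
      then have "(1 - fps_X ^ n :: rat fps) \<noteq> 0" by (metis fps_zero_nth)
      ultimately show ?thesis by simp
    qed (use init in simp)
    then show ?case using zero[of c] pos[of p c] less.prems by (cases "p = 0") auto
  qed
  show ?thesis by (rule fps_ext) (rule main[OF pc])
qed

lemma charges_Cons:
  assumes "0 < k"
  shows "\<exists>as. charges k = 0 # as \<and> distinct as \<and> set as = {1..k}"
proof -
  have "\<exists>as. charges k = 0 # as" by (cases k rule: charges.cases) simp_all
  then obtain as where as: "charges k = 0 # as" by blast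
  have "insert 0 (set as) = {0..k}" "0 \<notin> set as" "distinct as"
    using set_charges[of k] distinct_charges[of k] unfolding as by simp_all
  moreover from this have "set as = {0..k} - {0}" by blast
  moreover have "{0..k} - {0} = {1..k}" by (rule set_eqI) (simp add: Suc_le_eq conj_commute)
  ultimately have "set as = {1..k}" "distinct as" by (simp_all only:)
  then show ?thesis using as by blast
qed

text \<open>The increment in c comes from \<open>wrel\<close> with the charge 0 divided out, and the
  value at c = 0 from \<open>W_next\<close>, both at y = 1. For p = 0 the indices 1 and
  \<open>Suc k\<close> give the same by absorption.\<close>

lemma fermionic_recursion:
  assumes as: "charges k = 0 # as" "set as = {1..k}"
  defines "V \<equiv> \<lambda>p c. if p = 0 then eval_y1 (gser k as 0 0 1 (Suc c)) else eval_y1 (wser k as 0 0 p (Suc (p + c)))"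
  assumes pc: "p + c \<le> k"
  shows "V p c = (\<Sum>i\<le>c. fps_X ^ p * zscale (V i (k - p - i)))"
proof -
  have k: "set as \<subseteq> {..k}" using as by auto
  have pos: "supported (fser k as u)" for u by (rule supported_fser) (simp add: as)
  then have sg: "supported (gser k as \<alpha> \<beta> P S)" for \<alpha> \<beta> P S by (simp add: gser_def)
  then have sw: "supported (wser k as \<alpha> \<beta> P S)" for \<alpha> \<beta> P S by (simp add: wser_def supported_diff)
  have Suc_c: "V p (Suc c) = V p c + fps_X ^ p * zscale (V (Suc c) (k - p - Suc c))" if le: "p + Suc c \<le> k" for p c
  proof (cases p)
    case 0
    have "V 0 (Suc c) - V 0 c = zscale (V (Suc c) (k - Suc c))"
      using le 0 by (simp add: V_def wser_def eval_y1_diff gser_Suc_0[OF k] gser_beyond[OF k]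
          gser_commute[of _ _ _ _ "Suc k"] eval_y1_gser_Suc zscale_diff)
    with 0 show ?thesis by (simp add: algebra_simps)
  next
    case (Suc p')
    define b where "b = k - (p + Suc c)"
    have b: "p + Suc c + b = k" using le by (simp add: b_def)
    have "wser k (charges k) 0 0 p (Suc (p + Suc c)) - wser k (charges k) 0 0 p (p + Suc c)
      = zv ^ p * dser k (charges k) 1 0 (Suc c) (Suc (b + Suc c))"
      using wrel_drel[of k, unfolded wrel_def, THEN conjunct1, rule_format, OF b, of 0 0] by simp
    then have "adjoin0 0 (wser k as 0 0 p (Suc (p + Suc c)) - wser k as 0 0 p (p + Suc c)
      - zv ^ p * (dser k as 1 0 (Suc c) (Suc (b + Suc c)) + yv * wser k as 1 1 (Suc (Suc c)) (Suc (b + Suc c)))) = 0"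
      unfolding as(1) Suc add_Suc wser_adjoin0[OF k] dser_adjoin0[OF k]
      by (simp add: adjoin0_diff adjoin0_zv del: power_Suc)
    then have "wser k as 0 0 p (Suc (p + Suc c)) - wser k as 0 0 p (p + Suc c)
      = zv ^ p * (wser k as 1 0 (Suc c) (Suc (b + Suc c))
        - (wser k as 1 1 (Suc (Suc c)) (Suc (b + Suc c)) - yv * wser k as 1 1 (Suc (Suc c)) (Suc (b + Suc c))))"
      by (drule_tac adjoin0_eq_0) (simp add: dser_def algebra_simps)
    \<comment> \<open>The last two terms differ only by a factor y, so they cancel at y = 1.\<close>
    then have "eval_y1 (wser k as 0 0 p (Suc (p + Suc c)) - wser k as 0 0 p (p + Suc c))
      = eval_y1 (zv ^ p * wser k as 1 0 (Suc c) (Suc (b + Suc c)))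
        - (eval_y1 (zv ^ p * wser k as 1 1 (Suc (Suc c)) (Suc (b + Suc c)))
          - eval_y1 (yv * (zv ^ p * wser k as 1 1 (Suc (Suc c)) (Suc (b + Suc c)))))"
      by (simp add: right_diff_distrib eval_y1_diff mult_ac)
    moreover have "supported (zv ^ p * f)" if "supported f" for f
      using that by (auto simp: supported_def zv_power_nth fps_X_power_mult_nth)
    ultimately have "eval_y1 (wser k as 0 0 p (Suc (p + Suc c)) - wser k as 0 0 p (p + Suc c))
      = fps_X ^ p * zscale (eval_y1 (wser k as 0 0 (Suc c) (Suc (b + Suc c))))"
      using eval_y1_wser_Suc[of k as 0] by (simp add: eval_y1_yv eval_y1_zv sw)
    moreover have "k - p - Suc c = b" using b by simp
    ultimately show ?thesis using Suc by (simp add: V_def eval_y1_diff algebra_simps)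
  qed
  have c_0: "V p 0 = fps_X ^ p * zscale (V 0 (k - p))" if "p \<le> k" for p
  proof (cases p)
    case 0
    have "gser k as 0 0 1 1 = gser k as 1 0 1 (Suc k)"
      using gser_Suc_0[OF k, of k 0 0 1] by (simp add: gser_commute[of _ _ _ _ "Suc k"])
    then show ?thesis using eval_y1_gser_Suc[of k as 0 0 1] 0 by (simp add: V_def)
  next
    case (Suc p')
    have b: "p + (k - p) = k" using that by simp
    have "adjoin0 0 (wser k as 0 0 p (Suc p) - yv * (zv ^ p * gser k as 2 0 (Suc (k - p)) (Suc k))) = 0"
      using W_next[OF b, of 0 0] unfolding as(1) Suc wser_adjoin0[OF k] gser_adjoin0[OF k]
      by (simp add: adjoin0_diff adjoin0_zv adjoin0_yv mult.assoc numeral_2_eq_2 del: power_Suc)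
    then have "wser k as 0 0 p (Suc p) = yv * (zv ^ p * gser k as 2 0 (Suc (k - p)) (Suc k))"
      using adjoin0_eq_0 by fastforce
    then have "V p 0 = fps_X ^ p * eval_y1 (gser k as 2 0 (Suc (k - p)) (Suc k))"
      using Suc sg by (simp add: V_def eval_y1_yv eval_y1_zv supported_def zv_power_nth fps_X_power_mult_nth del: power_Suc)
    also have "gser k as 2 0 (Suc (k - p)) (Suc k) = gser k as 1 0 1 (Suc (k - p))"
      using gser_Suc_0[OF k, of k 1 0 "Suc (k - p)"] by (simp add: gser_commute[of _ _ _ _ "Suc k"] numeral_2_eq_2)
    finally show ?thesis using eval_y1_gser_Suc[of k as 0 0 1] by (simp add: V_def)
  qed
  show ?thesis using pc
  proof (induction c)
    case 0
    then show ?case using c_0[of p] by simp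
  next
    case (Suc c)
    then show ?case using Suc_c[of p c] by simp
  qed
qed

section \<open>Explicit exponents and configurations\<close>

definition vecs :: "nat list \<Rightarrow> nat \<Rightarrow> (nat \<Rightarrow> nat) set" where
  "vecs as n = {m. (\<forall>a. a \<notin> set as \<longrightarrow> m a = 0) \<and> (\<Sum>a\<in>set as. a * m a) = n}"

fun qexp :: "nat \<Rightarrow> nat list \<Rightarrow> (nat \<Rightarrow> nat) \<Rightarrow> (nat \<Rightarrow> nat) \<Rightarrow> nat" where
  "qexp N [] u m = 0"
| "qexp N (a # as) u m = Bn N a a * (m a choose 2) + u a * m a + qexp N as (\<lambda>b. u b + m a * Bn N a b) m"

lemma qexp_cong: "(\<And>a. a \<in> set as \<Longrightarrow> m a = m' a) \<Longrightarrow> qexp N as u m = qexp N as u m'"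
  by (induction as arbitrary: u) auto

text \<open>In \<open>qexp\<close> each unordered pair of charges is counted once, by the earlier
  charge in the list; the double sum counts it twice. The value is thus independent of the order of
  the list.\<close>

lemma qexp_double:
  "distinct as \<Longrightarrow> 2 * int (qexp N as u m) = (\<Sum>a\<in>set as. \<Sum>b\<in>set as. int (m a * Bn N a b * m b))
     - (\<Sum>a\<in>set as. int (Bn N a a * m a)) + 2 * (\<Sum>a\<in>set as. int (u a * m a))"
proof (induction as arbitrary: u)
  case (Cons a as)
  have "2 * (j choose 2) + j = j * j" for j :: nat
    by (induction j) (simp_all add: numeral_2_eq_2)
  then have ch: "2 * int (m a choose 2) = int (m a * m a) - int (m a)"
    by (metis add_diff_cancel_right' int_ops(7) of_nat_add of_nat_numeral)
  let ?C = "\<Sum>x\<in>set as. int (m a * Bn N a x * m x)"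
  have a: "a \<notin> set as" "distinct as" using Cons.prems by auto
  have C: "(\<Sum>x\<in>set as. int (m x * Bn N x a * m a)) = ?C"
    by (rule sum.cong) (simp_all add: Bn_sym mult_ac)
  have D: "(\<Sum>x\<in>set as. int ((u x + m a * Bn N a x) * m x)) = (\<Sum>x\<in>set as. int (u x * m x)) + ?C"
    by (simp add: sum.distrib algebra_simps)
  have "2 * int (qexp N (a # as) u m) = int (Bn N a a) * (2 * int (m a choose 2)) + 2 * int (u a * m a)
     + 2 * int (qexp N as (\<lambda>b. u b + m a * Bn N a b) m)"
    by simp
  also have "\<dots> = int (m a * Bn N a a * m a) - int (Bn N a a * m a) + 2 * int (u a * m a)
     + ((\<Sum>x\<in>set as. \<Sum>b\<in>set as. int (m x * Bn N x b * m b)) - (\<Sum>x\<in>set as. int (Bn N x x * m x))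
       + 2 * ((\<Sum>x\<in>set as. int (u x * m x)) + ?C))"
    unfolding ch Cons.IH[OF a(2)] D by (simp add: algebra_simps)
  finally show ?case
    using a by (simp only: list.set sum.insert finite_set not_False_eq_True sum.distrib C) simp
qed simp

lemma vecs_Cons:
  assumes "a \<notin> set as" "0 < a"
  shows "bij_betw (\<lambda>(j, m). m(a := j)) (Sigma {j. a * j \<le> n} (\<lambda>j. vecs as (n - a * j))) (vecs (a # as) n)"
proof (rule bij_betw_byWitness[where f' = "\<lambda>m. (m a, m(a := 0))"])
  have s: "(\<Sum>x\<in>set as. x * (if x = a then c else m x)) = (\<Sum>x\<in>set as. x * m x)" for c and m :: "nat \<Rightarrow> nat"
    by (rule sum.cong) (use assms in auto)
  show "\<forall>x\<in>Sigma {j. a * j \<le> n} (\<lambda>j. vecs as (n - a * j)).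
      (\<lambda>m. (m a, m(a := 0))) (case x of (j, m) \<Rightarrow> m(a := j)) = x"
    using assms by (auto simp: vecs_def fun_eq_iff)
  show "\<forall>m\<in>vecs (a # as) n. (case (m a, m(a := 0)) of (j, m) \<Rightarrow> m(a := j)) = m"
    by auto
  show "(\<lambda>(j, m). m(a := j)) ` (Sigma {j. a * j \<le> n} (\<lambda>j. vecs as (n - a * j))) \<subseteq> vecs (a # as) n"
    using assms by (auto simp: vecs_def s fun_upd_def)
  show "(\<lambda>m. (m a, m(a := 0))) ` vecs (a # as) n \<subseteq> Sigma {j. a * j \<le> n} (\<lambda>j. vecs as (n - a * j))"
    using assms by (auto simp: vecs_def s fun_upd_def)
qed

lemma finite_mult_le: "0 < a \<Longrightarrow> finite {j. a * j \<le> (n::nat)}"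
  by (rule finite_subset[of _ "{..n}"]) (auto intro: le_trans[rotated])

lemma finite_vecs: "distinct as \<Longrightarrow> \<forall>a\<in>set as. 0 < a \<Longrightarrow> finite (vecs as n)"
proof (induction as arbitrary: n)
  case Nil
  have "vecs [] n \<subseteq> {\<lambda>_. 0}" by (auto simp: vecs_def)
  then show ?case by (rule finite_subset) simp
next
  case (Cons a as)
  then have "finite (Sigma {j. a * j \<le> n} (\<lambda>j. vecs as (n - a * j)))"
    by (intro finite_SigmaI finite_mult_le) auto
  with bij_betw_finite[OF vecs_Cons[of a as n]] Cons.prems show ?case by auto
qed

lemma eval_y1_fser_nth:
  assumes "distinct as" "\<forall>a\<in>set as. 0 < a"
  shows "eval_y1 (fser N as u) $ n = (\<Sum>m\<in>vecs as n. fps_X ^ qexp N as u m * inverse (\<Prod>a\<in>set as. q_factorial (m a)))"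
  using assms
proof (induction as arbitrary: u n)
  case Nil
  have "vecs [] n = (if n = 0 then {\<lambda>_. 0} else {})" by (auto simp: vecs_def)
  moreover have "eval_y1 (1 :: ser3) $ n = (if n = 0 then 1 else 0)"
    unfolding eval_y1_nth by (subst sum.atMost_Suc_shift) simp
  ultimately show ?case by simp
next
  case (Cons a as)
  let ?h = "\<lambda>as u m. fps_X ^ qexp N as u m * inverse (\<Prod>a\<in>set as. q_factorial (m a))"
  have a: "a \<notin> set as" "0 < a" using Cons.prems by auto
  have "eval_y1 (fser N (a # as) u) $ n = (\<Sum>j | a * j \<le> n. qker (Bn N a a) (u a) j *
      eval_y1 (fser N as (\<lambda>b. u b + j * Bn N a b)) $ (n - a * j))"
    using Cons.prems by (simp add: eval_y1_msum supported_fser)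
  also have "\<dots> = (\<Sum>j | a * j \<le> n. \<Sum>m\<in>vecs as (n - a * j). qker (Bn N a a) (u a) j * ?h as (\<lambda>b. u b + j * Bn N a b) m)"
    using Cons by (simp add: sum_distrib_left)
  also have "\<dots> = (\<Sum>(j, m)\<in>Sigma {j. a * j \<le> n} (\<lambda>j. vecs as (n - a * j)).
      qker (Bn N a a) (u a) j * ?h as (\<lambda>b. u b + j * Bn N a b) m)"
    using Cons.prems by (intro sum.Sigma ballI finite_mult_le finite_vecs) auto
  also have "\<dots> = (\<Sum>m\<in>vecs (a # as) n. ?h (a # as) u m)"
  proof -
    have p: "(\<Prod>x\<in>set as. q_factorial (if x = a then j else m x)) = (\<Prod>x\<in>set as. q_factorial (m x))" for j m
      by (rule prod.cong) (use a in auto)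
    have e: "qexp N as v (\<lambda>x. if x = a then j else m x) = qexp N as v m" for v j m
      by (rule qexp_cong) (use a in auto)
    have "(\<Sum>x\<in>Sigma {j. a * j \<le> n} (\<lambda>j. vecs as (n - a * j)). ?h (a # as) u (case x of (j, m) \<Rightarrow> m(a := j)))
      = (\<Sum>(j, m)\<in>Sigma {j. a * j \<le> n} (\<lambda>j. vecs as (n - a * j)).
          qker (Bn N a a) (u a) j * ?h as (\<lambda>b. u b + j * Bn N a b) m)"
      using a by (intro sum.cong) (auto simp: fun_upd_def p e qker_def power_add fps_inverse_mult mult_ac)
    then show ?thesis
      using sum.reindex_bij_betw[OF vecs_Cons[OF a], of "?h (a # as) u" n] by simp
  qed
  finally show ?case .
qed

section \<open>Recursion for the characters of configurations\<close>

lemma admissible3_shift: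
  assumes "a \<in> configs3 k b0 b1"
  shows "a \<circ> Suc \<in> configs3 k (b1 - a 0) (k - a 0)" "weight a = a 0 + weight (a \<circ> Suc)"
    "energy a = energy (a \<circ> Suc) + weight (a \<circ> Suc)" "a 0 \<le> b0"
proof -
  have fin: "finite {i. a i \<noteq> 0}" and le: "\<And>i. a i \<le> k" and tr: "\<And>i. a i + a (i + 1) + a (i + 2) \<le> k"
    and b: "a 0 \<le> b0" "a 0 + a 1 \<le> b1"
    using assms by (auto simp: configs3_def admissible3_def)
  have "{i. (a \<circ> Suc) i \<noteq> 0} = Suc -` {i. a i \<noteq> 0}" by auto
  then have fin': "finite {i. (a \<circ> Suc) i \<noteq> 0}" using finite_vimageI[OF fin, of Suc] by simp
  show "a \<circ> Suc \<in> configs3 k (b1 - a 0) (k - a 0)"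
    using fin' le tr[of "Suc i" for i] tr[of 0] b
    by (simp add: configs3_def admissible3_def numeral_2_eq_2 comp_def le_diff_conv2 add_ac)
  \<comment> \<open>One identity serves both statistics: the constant 1 gives the weight and the
    identity function the energy.\<close>
  have sh: "(\<Sum>j | a j \<noteq> 0. f j * a j) = f 0 * a 0 + (\<Sum>j | (a \<circ> Suc) j \<noteq> 0. f (Suc j) * (a \<circ> Suc) j)" for f :: "nat \<Rightarrow> nat"
  proof -
    have "(\<Sum>j | a j \<noteq> 0. f j * a j) = (\<Sum>j\<in>insert 0 (Suc ` {j. (a \<circ> Suc) j \<noteq> 0}). f j * a j)"
      using fin fin' by (intro sum.mono_neutral_left) (auto simp: image_iff gr0_conv_Suc dest: not0_implies_Suc)
    also have "\<dots> = f 0 * a 0 + (\<Sum>j | (a \<circ> Suc) j \<noteq> 0. f (Suc j) * (a \<circ> Suc) j)"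
      using fin' by (simp add: sum.reindex)
    finally show ?thesis .
  qed
  show "weight a = a 0 + weight (a \<circ> Suc)"
    using sh[of "\<lambda>_. 1"] by (simp add: weight_def)
  show "energy a = energy (a \<circ> Suc) + weight (a \<circ> Suc)"
    using sh[of "\<lambda>j. j"] by (simp add: weight_def energy_def sum.distrib)
  show "a 0 \<le> b0" by (rule b)
qed

lemma case_nat_configs3:
  assumes "a \<in> configs3 k (b1 - i) (k - i)" "i \<le> b0" "i \<le> b1" "b1 \<le> k"
  shows "case_nat i a \<in> configs3 k b0 b1"
proof -
  have fin: "finite {i. a i \<noteq> 0}" and le: "\<And>i. a i \<le> k" and tr: "\<And>i. a i + a (i + 1) + a (i + 2) \<le> k"
    and b: "a 0 \<le> b1 - i" "a 0 + a 1 \<le> k - i"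
    using assms by (auto simp: configs3_def admissible3_def)
  have "{j. case_nat i a j \<noteq> 0} \<subseteq> insert 0 (Suc ` {j. a j \<noteq> 0})"
  proof
    fix j assume "j \<in> {j. case_nat i a j \<noteq> 0}"
    then show "j \<in> insert 0 (Suc ` {j. a j \<noteq> 0})" by (cases j) auto
  qed
  then have "finite {j. case_nat i a j \<noteq> 0}" using fin by (auto intro: finite_subset)
  moreover have "case_nat i a j \<le> k" for j using le assms by (auto split: nat.split)
  moreover have "case_nat i a j + case_nat i a (j + 1) + case_nat i a (j + 2) \<le> k" for j
  proof (cases j)
    case 0
    then show ?thesis using b assms by (simp add: numeral_2_eq_2)
  next
    case (Suc j')
    then show ?thesis using tr[of j'] by (simp add: numeral_2_eq_2)
  qed
  ultimately show ?thesis using assms b by (simp add: configs3_def admissible3_def)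
qed

lemma character3_nth: "character3 k b0 b1 $ n $ d = of_nat (card {a \<in> configs3 k b0 b1. energy a = d \<and> weight a = n})"
  by (simp add: character3_def)

text \<open>Split off the first entry i. Moving the tail one place adds its weight to the energy,
  which is the substitution of q z for z.\<close>

lemma character3_recursion:
  assumes "b0 \<le> b1" "b1 \<le> k"
  shows "character3 k b0 b1 = (\<Sum>i\<le>b0. fps_X ^ i * zscale (character3 k (b1 - i) (k - i)))"
proof (intro fps_ext)
  fix n d
  let ?S = "\<lambda>i. {a \<in> configs3 k (b1 - i) (k - i). energy a + weight a = d \<and> i + weight a = n}"
  have fin: "finite (?S i)" for i
    by (rule finite_subset[OF _ finite_configs3_energy[of k "b1 - i" "k - i" "d - (n - i)"]]) auto
  have "bij_betw (\<lambda>(i, a). case_nat i a) (Sigma {..b0} ?S) {a \<in> configs3 k b0 b1. energy a = d \<and> weight a = n}"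
  proof (rule bij_betw_byWitness[where f' = "\<lambda>a. (a 0, a \<circ> Suc)"])
    show "\<forall>x\<in>Sigma {..b0} ?S. (\<lambda>a. (a 0, a \<circ> Suc)) (case x of (i, a) \<Rightarrow> case_nat i a) = x"
      by (auto simp: fun_eq_iff)
    show "\<forall>a\<in>{a \<in> configs3 k b0 b1. energy a = d \<and> weight a = n}. (case (a 0, a \<circ> Suc) of (i, a) \<Rightarrow> case_nat i a) = a"
      by (auto simp: fun_eq_iff split: nat.split)
    show "(\<lambda>(i, a). case_nat i a) ` Sigma {..b0} ?S \<subseteq> {a \<in> configs3 k b0 b1. energy a = d \<and> weight a = n}"
    proof (rule image_subsetI)
      fix x assume xS: "x \<in> Sigma {..b0} ?S"
      obtain i a where x: "x = (i, a)" by (cases x)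
      have i: "i \<in> {..b0}" and a: "a \<in> configs3 k (b1 - i) (k - i)"
        and eq: "energy a + weight a = d" "i + weight a = n"
        using xS unfolding x by simp_all
      have c: "case_nat i a \<in> configs3 k b0 b1"
        by (rule case_nat_configs3[OF a]) (use i assms in auto)
      moreover have "case_nat i a \<circ> Suc = a" by (simp add: fun_eq_iff)
      ultimately show "(case x of (i, a) \<Rightarrow> case_nat i a) \<in> {a \<in> configs3 k b0 b1. energy a = d \<and> weight a = n}"
        using admissible3_shift(2,3)[OF c] eq by (simp add: x)
    qed
    show "(\<lambda>a. (a 0, a \<circ> Suc)) ` {a \<in> configs3 k b0 b1. energy a = d \<and> weight a = n} \<subseteq> Sigma {..b0} ?S"
    proof (rule image_subsetI)
      fix a assume "a \<in> {a \<in> configs3 k b0 b1. energy a = d \<and> weight a = n}"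
      then have a: "a \<in> configs3 k b0 b1" "energy a = d" "weight a = n" by simp_all
      show "(a 0, a \<circ> Suc) \<in> Sigma {..b0} ?S"
        using admissible3_shift[OF a(1)] a(2,3) by simp
    qed
  qed
  then have "card {a \<in> configs3 k b0 b1. energy a = d \<and> weight a = n} = card (Sigma {..b0} ?S)"
    by (rule bij_betw_same_card[symmetric])
  also have "\<dots> = (\<Sum>i\<le>b0. card (?S i))"
    using fin by (intro card_SigmaI) auto
  finally have "character3 k b0 b1 $ n $ d = (\<Sum>i\<le>b0. of_nat (card (?S i)))"
    by (simp add: character3_nth)
  also have "\<dots> = (\<Sum>i\<le>b0. (fps_X ^ i * zscale (character3 k (b1 - i) (k - i))) $ n $ d)"
  proof (rule sum.cong[OF refl])
    fix i
    show "rat_of_nat (card (?S i)) = (fps_X ^ i * zscale (character3 k (b1 - i) (k - i))) $ n $ d"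
    proof (cases "n < i \<or> d < n - i")
      case True
      then have "?S i = {}" by auto
      then have "card (?S i) = 0" by (simp only: card.empty)
      with True show ?thesis by (auto simp: fps_X_power_mult_nth zscale_nth)
    next
      case False
      then have "?S i = {a \<in> configs3 k (b1 - i) (k - i). energy a = d - (n - i) \<and> weight a = n - i}" by auto
      then have "card (?S i) = card {a \<in> configs3 k (b1 - i) (k - i). energy a = d - (n - i) \<and> weight a = n - i}"
        by (simp only:)
      with False show ?thesis by (simp add: fps_X_power_mult_nth zscale_nth character3_nth)
    qed
  qed
  also have "\<dots> = (\<Sum>i\<le>b0. fps_X ^ i * zscale (character3 k (b1 - i) (k - i))) $ n $ d"
    by (simp add: fps_sum_nth)
  finally show "character3 k b0 b1 $ n $ d = (\<Sum>i\<le>b0. fps_X ^ i * zscale (character3 k (b1 - i) (k - i))) $ n $ d" .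
qed

lemma character3_nth_0: "character3 k b0 b1 $ 0 = 1"
proof (rule fps_ext)
  fix d
  have eq: "{a \<in> configs3 k b0 b1. energy a = d \<and> weight a = 0} = (if d = 0 then {\<lambda>_. 0} else {})"
  proof -
    have only: "a = (\<lambda>_. 0)" if "a \<in> configs3 k b0 b1" "weight a = 0" for a
      using that by (auto simp: configs3_def admissible3_def weight_def fun_eq_iff)
    have zero: "(\<lambda>_. 0) \<in> configs3 k b0 b1" "energy (\<lambda>_. 0) = 0" "weight (\<lambda>_. 0) = 0"
      by (simp_all add: configs3_def admissible3_def energy_def weight_def)
    show ?thesis
    proof (rule set_eqI)
      fix a :: "nat \<Rightarrow> nat"
      show "a \<in> {a \<in> configs3 k b0 b1. energy a = d \<and> weight a = 0} \<longleftrightarrow> a \<in> (if d = 0 then {\<lambda>_. 0} else {})"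
        using only[of a] zero by (cases "a = (\<lambda>_. 0)") auto
    qed
  qed
  have "card {a \<in> configs3 k b0 b1. energy a = d \<and> weight a = 0} = (if d = 0 then 1 else 0)"
    unfolding eq by simp
  then show "character3 k b0 b1 $ 0 $ d = 1 $ d"
    by (simp add: character3_nth)
qed

lemma zscale_sum: "zscale (\<Sum>i\<in>A. f i) = (\<Sum>i\<in>A. zscale (f i))"
  by (rule fps_ext) (simp add: zscale_nth fps_sum_nth sum_distrib_left)

lemma character3_eq_eval_y1:
  assumes "c \<le> k" "charges k = 0 # as" "set as = {1..k}"
  shows "character3 k c k = eval_y1 (fser k as (\<lambda>b. b - c))"
proof -
  \<comment> \<open>The factor z^p and the substitution of q z for z give the characters the form of
    the recursion in \<open>zrec_unique\<close>.\<close>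
  define U where "U p c = fps_X ^ p * zscale (character3 k c (k - p))" for p c
  define V where "V p c = (if p = 0 then eval_y1 (gser k as 0 0 1 (Suc c)) else eval_y1 (wser k as 0 0 p (Suc (p + c))))" for p c
  have "U 0 c = V 0 c"
  proof (rule zrec_unique[where k = k])
    fix p c assume pc: "p + c \<le> k"
    have "U p c = fps_X ^ p * zscale (\<Sum>i\<le>c. U i (k - p - i))"
      unfolding U_def using pc
      by (subst character3_recursion) (auto intro!: arg_cong[where f = zscale] sum.cong simp: diff_diff_eq add.commute)
    also have "\<dots> = (\<Sum>i\<le>c. fps_X ^ p * zscale (U i (k - p - i)))"
      by (simp only: zscale_sum sum_distrib_left)
    finally show "U p c = (\<Sum>i\<le>c. fps_X ^ p * zscale (U i (k - p - i)))" .
    show "V p c = (\<Sum>i\<le>c. fps_X ^ p * zscale (V i (k - p - i)))"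
      unfolding V_def by (rule fermionic_recursion[OF assms(2,3) pc])
  next
    have "supported (fser k as u)" for u by (rule supported_fser) (simp add: assms)
    then have "V 0 k $ 0 = 1"
      by (simp add: V_def gser_def eval_y1_nth fser_nth_0 supported_def)
    then show "U 0 k $ 0 = V 0 k $ 0"
      by (simp add: U_def zscale_nth character3_nth_0)
  qed (use assms in simp)
  \<comment> \<open>At p = 0 the linear term is g(c) + g(0), and g(0) = b is again a substitution of
    q z for z, which cancels.\<close>
  then have "zscale (character3 k c k) = eval_y1 (fser k as (\<lambda>b. (b - c) + b))"
    by (simp add: U_def V_def gser_def add.commute)
  then show ?thesis unfolding eval_y1_fser_zscale by (rule zscale_inj)
qed

theorem theorem9p9:
  fixes k :: nat
  assumes "k \<ge> 1"
  shows "character3 k ((k + 1) div 2) k =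
    Abs_fps (\<lambda>n. \<Sum>m\<in>mvecs k n.
      fps_X ^ nat (exponent k ((k + 1) div 2) m) / (\<Prod>a=1..k. q_factorial (m a)))"
proof (rule fps_ext)
  fix n
  define c where "c = (k + 1) div 2"
  have c: "c \<le> k" using assms by (simp add: c_def)
  obtain as where as: "charges k = 0 # as" "distinct as" "set as = {1..k}"
    using charges_Cons[of k] assms by auto
  have "qexp k as (\<lambda>b. b - c) m = nat (exponent k c m)" for m
  proof -
    have B: "int (Bn k a b) = Bmat k a b" for a b by (simp add: Bn_def Bmat_def)
    have C: "int (a - c) = cvec2 c a" for a by (simp add: cvec2_def)
    \<comment> \<open>The identity is doubled because \<open>exponent\<close> halves
      \<open>quad_part\<close>.\<close>
    have "2 * int (qexp k as (\<lambda>b. b - c) m) = quad_part k m + 2 * (\<Sum>a=1..k. cvec2 c a * int (m a))"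
      unfolding qexp_double[OF as(2)] as(3) quad_part_def by (simp add: B C)
    then have "int (qexp k as (\<lambda>b. b - c) m) = exponent k c m" by (simp add: exponent_def)
    then show ?thesis by simp
  qed
  moreover have "vecs as n = mvecs k n" by (simp add: vecs_def mvecs_def as(3))
  moreover have "(\<Prod>a=1..k. q_factorial (m a)) $ 0 \<noteq> 0" for m
  proof -
    have "prod f A $ 0 = (\<Prod>a\<in>A. f a $ 0)" for f :: "nat \<Rightarrow> rat fps" and A
      by (induction A rule: infinite_finite_induct) simp_all
    then show ?thesis by (simp add: q_factorial_nth_0)
  qed
  ultimately have "character3 k c k $ n = (\<Sum>m\<in>mvecs k n. fps_X ^ nat (exponent k c m) / (\<Prod>a=1..k. q_factorial (m a)))"
    by (simp add: character3_eq_eval_y1[OF c as(1,3)] eval_y1_fser_nth as fps_divide_unit)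
  then show "character3 k ((k + 1) div 2) k $ n = Abs_fps (\<lambda>n. \<Sum>m\<in>mvecs k n.
      fps_X ^ nat (exponent k ((k + 1) div 2) m) / (\<Prod>a=1..k. q_factorial (m a))) $ n"
    by (simp add: c_def)
qed

end
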